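(* Let $\mathbf{\Sigma}$: $\dot x(t)=-\mathcal{L}x(t)+Fu(t)$, $y(t)=Hx(t)$ be a directed network system on a weakly connected weighted digraph $\mathcal{G}$ with $n$ vertices, and let $\hat{\mathbf{\Sigma}}$: $\dot z(t)=-\hat{\mathcal{L}}z(t)+\hat Fu(t)$, $\hat y(t)=\hat Hz(t)$ be the reduced-order network system with $\hat{\mathcal{L}}=\Pi^\dagger\mathcal{L}\Pi$, $\hat F=\Pi^\dagger F$, $\hat H=H\Pi$, where $\Pi\in\mathbb{R}^{n\times r}$ is the characteristic matrix of a proper clustering of $\mathcal{G}$ and $\Pi^\dagger=(\Pi^\top M\Pi)^{-1}\Pi^\top M$. Let $\mathcal{P}_o$ and $\mathcal{P}_r$ be the pseudo controllability Gramians of $\mathbf{\Sigma}$ and $\hat{\mathbf{\Sigma}}$, respectively. Then $$\|\mathbf{\Sigma}-\hat{\mathbf{\Sigma}}\|_{\mathcal{H}_2}^2=\mathrm{tr}\left[H(\mathcal{P}_o+\Pi\mathcal{P}_r\Pi^\top-2\Pi\mathcal{P}_x)H^\top\right],$$ where $\mathcal{P}_x:=\tilde{\mathcal{P}}_x-\Pi^\dagger\mathcal{J}\Pi\tilde{\mathcal{P}}_x\mathcal{J}^\top\in\mathbb{R}^{r\times n}$, $\mathcal{J}=\lim_{\tau\to\infty}e^{-\mathcal{L}\tau}$, and $\tilde{\mathcal{P}}_x\in\mathbb{R}^{r\times n}$ is an arbitrary solution of the Sylvester equation $$\hat{\mathcal{L}}\tilde{\mathcal{P}}_x+\tilde{\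mathcal{P}}_x\mathcal{L}^\top-\Pi^\dagger(I-\mathcal{J})FF^\top(I-\mathcal{J}^\top)=0.$$
   Context: Digraphs: $\mathcal{G}=(\mathbb{V},\mathbb{E})$ with $\mathbb{V}=\{1,\dots,n\}$; an edge $(i,j)\in\mathbb{E}$ means that information flows from vertex $j$ to vertex $i$ and has weight $w_{ij}>0$; $w_{ij}=0$ if $(i,j)\notin\mathbb{E}$. The Laplacian is $\mathcal{L}=\mathrm{diag}(\mathcal{W}\mathbf{1})-\mathcal{W}$, $\mathcal{W}=[w_{ij}]$. $\mathcal{G}$ is weakly connected if there is an undirected path between any two vertices. A strongly connected component (SCC) is a maximal strongly connected subgraph; a leading SCC (LSCC) is an SCC that has only outflows (no edge brings information into it from outside). A weakly connected weighted digraph is generalized balanced if each LSCC $\mathcal{S}_k$ satisfies $\sum_{j\in\mathcal{S}_k}w_{ij}=\sum_{j\in\mathcal{S}_k}w_{ji}$ for all $i\in\mathcal{S}_k$. There is a positive diagonal matrix $M$ such that $L:=M\mathcal{L}$ is the Laplacian matrix of a generalized balanced digraph; fix such an $M$ whose diagonal entries at vertices outside all LSCCs are equal to $1$, and let $L=M\mathcal{L}$. With $\mathbf e_i$ the $i$-th column of $I_n$ and $\mathbf e_{ij}=\mathbf e_i-\mathbf e_j$, vertices $i$ and $j$ are clusterable if $\mathbf e_{ij}\in\ker(L)^\perp$ and $\mathbf e_{ij}\in\ker(L^\top)^\perp$. A graph clustering of $\mathcal{G}$ is a partition of $\mathbb{V}$ into $r$ nonempty disjoint cells $\mathcal{C}_1,\dots,\mathcal{C}_r$;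 its characteristic matrix $\Pi\in\mathbb{R}^{n\times r}$ has $\Pi_{ij}=1$ if $i\in\mathcal{C}_j$ and $0$ otherwise. The clustering is proper if the vertices in each cell are (pairwise) clusterable. For a semistable system $\dot x=Ax+Bu$, $y=Cx$ (i.e. $\lim_{t\to\infty}x(t)$ exists for all $x(0)$ when $u=0$), the pseudo controllability Gramian is $\int_0^\infty(e^{A\tau}-J_A)BB^\top(e^{A^\top\tau}-J_A^\top)\,d\tau$ with $J_A=\lim_{\tau\to\infty}e^{A\tau}$. $\|\mathbf{\Sigma}-\hat{\mathbf{\Sigma}}\|_{\mathcal{H}_2}$ is the $\mathcal{H}_2$-norm of $H(sI_n+\mathcal{L})^{-1}F-\hat H(sI_r+\hat{\mathcal{L}})^{-1}\hat F$. *)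

theory Defs
  imports "HOL-Analysis.Analysis" "Graph_Theory.Graph_Theory"
begin

text \<open>
  The vertex set is the finite type \<open>'n\<close>. A pair \<open>(i, j)\<close> is an edge along which information flows
  from \<open>j\<close> to \<open>i\<close>; hence its tail is the second and its head the first component. Self-loops are
  not excluded (they cancel in the Laplacian).
\<close>

definition digraph_of :: "('n \<times> 'n) set \<Rightarrow> ('n, 'n \<times> 'n) pre_digraph" where
  "digraph_of E = \<lparr>verts = UNIV, arcs = E, tail = snd, head = fst\<rparr>"

definition weighted_digraph :: "('n::finite \<times> 'n) set \<Rightarrow> real^'n^'n \<Rightarrow> bool" where
  "weighted_digraph E W \<longleftrightarrow>
     (\<forall>i j. ((i, j) \<in> E \<longrightarrow> W $ i $ j > 0) \<and> ((i, j) \<notin> E \<longrightarrow> W $ i $ j = 0))"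

text \<open>The library's \<open>connected\<close> for digraphs refers to the underlying symmetric digraph.\<close>

definition weakly_connected :: "('n \<times> 'n) set \<Rightarrow> bool" where
  "weakly_connected E \<longleftrightarrow> Digraph_Component.connected (digraph_of E)"

definition lscc :: "('n \<times> 'n) set \<Rightarrow> 'n set \<Rightarrow> bool" where
  "lscc E S \<longleftrightarrow> S \<in> pre_digraph.sccs_verts (digraph_of E) \<and> (\<forall>(i, j) \<in> E. i \<in> S \<longrightarrow> j \<in> S)"

definition generalized_balanced :: "('n::finite \<times> 'n) set \<Rightarrow> real^'n^'n \<Rightarrow> bool" where
  "generalized_balanced E W \<longleftrightarrow>
     weighted_digraph E W \<and> weakly_connected E \<and>
     (\<forall>S. lscc E S \<longrightarrow> (\<forall>i\<in>S. (\<Sum>j\<in>S. W $ i $ j) = (\<Sum>j\<in>S. W $ j $ i)))"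

definition diag_mat :: "'a::zero^'n \<Rightarrow> 'a^'n^'n" where
  "diag_mat d = (\<chi> i j. if i = j then d $ i else 0)"

definition laplacian :: "real^'n^'n \<Rightarrow> real^'n^'n" where
  "laplacian W = diag_mat (W *v 1) - W"

text \<open>
  The admissible diagonal scalings \<open>M\<close> of the Laplacian of \<open>(E, W)\<close>: positive diagonal, equal to
  \<open>1\<close> outside all leading components, and turning the Laplacian into that of a generalized balanced
  digraph on the same vertices.
\<close>

definition balancing_matrix :: "('n::finite \<times> 'n) set \<Rightarrow> real^'n^'n \<Rightarrow> real^'n^'n \<Rightarrow> bool" where
  "balancing_matrix E W M \<longleftrightarrow>
     (\<exists>m. (\<forall>i. m $ i > 0) \<and> M = diag_mat m) \<and>
     (\<exists>E' W'. generalized_balanced E' W' \<and> M ** laplacian W = laplacian W') \<and>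
     (\<forall>i. (\<nexists>S. lscc E S \<and> i \<in> S) \<longrightarrow> M $ i $ i = 1)"

definition mat_ker :: "real^'n^'m \<Rightarrow> (real^'n) set" where
  "mat_ker A = {x. A *v x = 0}"

definition clusterable :: "real^'n^'n \<Rightarrow> 'n \<Rightarrow> 'n \<Rightarrow> bool" where
  "clusterable L i j \<longleftrightarrow>
     axis i 1 - axis j 1 \<in> (mat_ker L)\<^sup>\<bottom> \<and> axis i 1 - axis j 1 \<in> (mat_ker (transpose L))\<^sup>\<bottom>"

text \<open>The cells are indexed by a finite type, whose cardinality is the number of cells.\<close>

definition graph_clustering :: "('r \<Rightarrow> 'n set) \<Rightarrow> bool" where
  "graph_clustering C \<longleftrightarrow> (\<forall>k. C k \<noteq> {}) \<and> disjoint_family C \<and> (\<Union>k. C k) = UNIV"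

definition proper_clustering :: "real^'n^'n \<Rightarrow> ('r \<Rightarrow> 'n set) \<Rightarrow> bool" where
  "proper_clustering L C \<longleftrightarrow>
     graph_clustering C \<and> (\<forall>k. \<forall>i\<in>C k. \<forall>j\<in>C k. clusterable L i j)"

definition char_matrix :: "('r \<Rightarrow> 'n set) \<Rightarrow> real^'r^'n" where
  "char_matrix C = (\<chi> i k. if i \<in> C k then 1 else 0)"

definition weighted_pinv :: "real^'n^'n \<Rightarrow> real^'r^'n \<Rightarrow> real^'n^'r" where
  "weighted_pinv M Q = matrix_inv (transpose Q ** M ** Q) ** transpose Q ** M"

text \<open>
  The exponential and power of the library are not usable for matrices, since multiplication on
  the type of matrices is componentwise.
\<close>

definition matrix_exp :: "real^'n^'n \<Rightarrow> real^'n^'n" where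
  "matrix_exp A = (\<Sum>k. (1 / fact k) *\<^sub>R (((**) A ^^ k) (mat 1)))"

text \<open>The limit exists for every semistable \<open>A\<close>, in particular for negated Laplacians.\<close>

definition exp_limit :: "real^'n^'n \<Rightarrow> real^'n^'n" where
  "exp_limit A = Lim at_top (\<lambda>t. matrix_exp (t *\<^sub>R A))"

definition pseudo_ctrb_gramian :: "real^'n^'n \<Rightarrow> real^'p^'n \<Rightarrow> real^'n^'n" where
  "pseudo_ctrb_gramian A B =
     integral {0..} (\<lambda>t. (matrix_exp (t *\<^sub>R A) - exp_limit A) ** B ** transpose B **
                         (matrix_exp (t *\<^sub>R transpose A) - transpose (exp_limit A)))"

definition transfer_function ::
    "real^'n^'n \<Rightarrow> real^'p^'n \<Rightarrow> real^'n^'q \<Rightarrow> complex \<Rightarrow> complex^'p^'q" where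
  "transfer_function A B C s =
     map_matrix of_real C ** matrix_inv (mat s - map_matrix of_real A) ** map_matrix of_real B"

text \<open>
  Hardy space of the open right half-plane. The norm of a matrix of type \<open>complex^'p^'q\<close> is the Frobenius norm. The supremum over vertical
  lines in the open right half-plane is taken instead of the integral over the imaginary axis, so
  that resolvents that are singular at \<open>0\<close> are never evaluated there.
\<close>

definition h2_square :: "(complex \<Rightarrow> complex^'p^'q) \<Rightarrow> ennreal" where
  "h2_square G =
     (SUP \<sigma>\<in>{0<..}. ennreal (1 / (2 * pi)) *
        (\<integral>\<^sup>+ \<omega>. ennreal ((norm (G (Complex \<sigma> \<omega>)))\<^sup>2) \<partial>lborel))"

definition in_h2 :: "(complex \<Rightarrow> complex^'p^'q) \<Rightarrow> bool" where
  "in_h2 G \<longleftrightarrow>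
     (\<forall>i j. (\<lambda>s. G s $ i $ j) holomorphic_on {s. Re s > 0}) \<and> h2_square G < \<infinity>"

definition h2_norm :: "(complex \<Rightarrow> complex^'p^'q) \<Rightarrow> real" where
  "h2_norm G = sqrt (enn2real (h2_square G))"

end

theory Submission
  imports Defs "HOL-Probability.Characteristic_Functions" "HOL-Real_Asymp.Real_Asymp"
begin

text \<open>
  The error system has the impulse response \<open>H (T(t) - Q Tr(t) Qd) F\<close> with \<open>T(t) = exp (- \<L> t)\<close> and
  \<open>Tr(t) = exp (- \<L>r t)\<close>, and its transfer function is the Laplace transform of this response. By Plancherel
  the squared norm is the integral of the squared Frobenius norm of the response over \<open>[0, \<infinity>)\<close>.

  Both \<open>\<L>\<close> and \<open>\<L>r\<close> have zero row sums and nonpositive off-diagonal entries, so \<open>T\<close> and \<open>Tr\<close> are row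
  stochastic, and a maximum principle with a compactness argument gives exponential convergence to
  \<open>J\<close> and \<open>Jr\<close>. Clusterability says that the columns of \<open>J\<close> and, after scaling by the inverse of \<open>M\<close>,
  its rows are constant on cells; hence \<open>J = Q Qd J = J Q Qd\<close>, and a maximum principle on the quotient
  yields \<open>Jr = Qd J Q\<close>. Thus the response is \<open>H (T(t) - J) F - H Q (Tr(t) - Jr) Qd F\<close>, and expanding the square
  leaves the two Gramians and a cross Gramian, which is read off from the Sylvester equation by integrating
  the derivative of \<open>Tr(t) Pt T(t)\<^sup>T\<close>.
\<close>

section \<open>The Plancherel identity\<close>

text \<open>The obstacle is the eigenvalue 0 of both Laplacians. The vector of ones is fixed by T,
  so no contraction holds on the whole space, and \<open>\<L>\<close> need not be symmetric, so no
  orthogonal eigenbasis yields a rate. On the range of \<open>\<L>\<close>, which T leaves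
  invariant, T(1) strictly shortens every vector of maximum norm 1; compactness of the unit sphere
  of the range makes the factor uniform. As the derivative of T(t) is - T(t) \<open>\<L>\<close>, it
  decays exponentially, and integrating it yields the limit together with a rate. For the same
  reason the Sylvester equation has many solutions. A homogeneous solution N satisfies Tr(t) N
  T(t)^T = N for all t, hence N = Jr N J^T; subtracting Jr Pt J^T from Pt removes the ambiguity. The
  resolvents are singular at s = 0. Plancherel is therefore used on each line Re s = \<sigma> > 0,
  for the response damped by exp (- \<sigma> t), and monotone convergence in \<sigma> recovers the
  undamped integral.\<close>

lemma integral_std_normal_cos:
  "has_bochner_integral lborel (\<lambda>u. std_normal_density u * cos (a * u)) (exp (- a\<^sup>2 / 2))"
proof -
  have "integrable lborel (\<lambda>u. std_normal_density u * cos (a * u))"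
    by (rule Bochner_Integration.integrable_bound[OF integrable_std_normal_moment[of 0]])
      (auto simp: abs_mult intro!: AE_I2 mult_left_le)
  moreover have "(LINT u|lborel. std_normal_density u * cos (a * u)) = exp (- a\<^sup>2 / 2)"
  proof -
    have int: "integrable std_normal_distribution (\<lambda>x. iexp (a * x))"
      by (intro prob_space.integrable_iexp real_distribution.axioms(1) real_dist_normal_dist) auto
    have "exp (- a\<^sup>2 / 2) = Re (char std_normal_distribution a)"
      by (simp add: char_std_normal_distribution)
    also have "\<dots> = (LINT u|std_normal_distribution. Re (iexp (a * u)))"
      unfolding char_def using int by (rule integral_Re[symmetric])
    also have "\<dots> = (LINT u|lborel. std_normal_density u * cos (a * u))"
      by (subst integral_density) (auto simp: Re_exp)
    finally show ?thesis by simp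
  qed
  ultimately show ?thesis by (simp add: has_bochner_integral_iff)
qed

text \<open>Up to scaling the Gaussian is its own Fourier transform: a wide weight in frequency
  turns into an approximate identity of width \<delta> in time.\<close>

lemma integral_scaled_std_normal_cos:
  assumes "0 < \<delta>"
  shows "(LINT \<omega>|lborel. std_normal_density (\<delta> * \<omega>) * cos (\<omega> * x)) =
    sqrt (2 * pi) / \<delta> * std_normal_density (x / \<delta>)"
proof -
  have "exp (- (x / \<delta>)\<^sup>2 / 2) = (LINT u|lborel. std_normal_density u * cos (x / \<delta> * u))"
    using has_bochner_integral_integral_eq[OF integral_std_normal_cos[of "x / \<delta>"]] by simp
  also have "\<dots> = \<bar>\<delta>\<bar> *\<^sub>R (LINT \<omega>|lborel. std_normal_density (0 + \<delta> * \<omega>) * cos (x / \<delta> * (0 + \<delta> * \<omega>)))"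
    using assms by (intro lborel_integral_real_affine) auto
  also have "\<dots> = \<delta> * (LINT \<omega>|lborel. std_normal_density (\<delta> * \<omega>) * cos (\<omega> * x))"
    using assms by (simp add: mult.commute)
  finally show ?thesis using assms by (simp add: std_normal_density_def field_simps real_sqrt_mult)
qed

lemma integrable_scaled_std_normal:
  assumes "0 < \<delta>"
  shows "integrable lborel (\<lambda>\<omega>. std_normal_density (\<delta> * \<omega>))"
  using lborel_integrable_real_affine[OF integrable_std_normal_moment[of 0], of \<delta> 0] assms by simp

text \<open>The product \<open>f x * g y\<close> is integrable over the plane and a bounded kernel
  preserves this; it licenses both exchanges of integrals in
  \<open>plancherel_gaussian\<close>.\<close>

lemma integrable_pair_mult_bounded:
  fixes f g :: "real \<Rightarrow> real" and k :: "real \<times> real \<Rightarrow> real"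
  assumes f: "integrable lborel f" and g: "integrable lborel g"
    and k: "k \<in> borel_measurable (lborel \<Otimes>\<^sub>M lborel)" "\<And>x y. \<bar>k (x, y)\<bar> \<le> B"
  shows "integrable (lborel \<Otimes>\<^sub>M lborel) (\<lambda>(x, y). f x * g y * k (x, y))"
proof (rule Bochner_Integration.integrable_bound)
  have [measurable]: "f \<in> borel_measurable borel" "g \<in> borel_measurable borel"
    using f g by auto
  show "integrable (lborel \<Otimes>\<^sub>M lborel) (\<lambda>(x, y). f x * g y * B)"
  proof (rule lborel_pair.Fubini_integrable)
    show "integrable lborel (\<lambda>x. LINT y|lborel. norm (case (x, y) of (x, y) \<Rightarrow> f x * g y * B))"
      using f g by (simp add: abs_mult)
    show "AE x in lborel. integrable lborel (\<lambda>y. case (x, y) of (x, y) \<Rightarrow> f x * g y * B)"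
      using g by simp
  qed simp
  have "\<bar>k (x, y)\<bar> \<le> \<bar>B\<bar>" for x y using k(2)[of x y] by linarith
  thus "AE x in lborel \<Otimes>\<^sub>M lborel. norm (case x of (x, y) \<Rightarrow> f x * g y * k (x, y)) \<le> norm (case x of (x, y)
      \<Rightarrow> f x * g y * B)"
    by (auto simp: abs_mult intro!: AE_I2 mult_left_mono)
  show "(\<lambda>(x, y). f x * g y * k (x, y)) \<in> borel_measurable (lborel \<Otimes>\<^sub>M lborel)"
    using k(1) by measurable
qed

text \<open>
  The Gaussian weight makes the order of integration exchangeable; as \<open>\<delta>\<close> tends to \<open>0\<close>, the weight increases
  to a constant and the convolution on the right tends to \<open>g t\<close>.
\<close>

lemma plancherel_gaussian:
  fixes g :: "real \<Rightarrow> real"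
  assumes g: "integrable lborel g" and \<delta>: "0 < \<delta>"
  shows "(LINT \<omega>|lborel. std_normal_density (\<delta> * \<omega>) *
        ((LINT t|lborel. g t * cos (\<omega> * t))\<^sup>2 + (LINT t|lborel. g t * sin (\<omega> * t))\<^sup>2)) =
      sqrt (2 * pi) * (LINT t|lborel. g t * (LINT u|lborel. g (t - \<delta> * u) * std_normal_density u))"
proof -
  have [measurable]: "g \<in> borel_measurable borel" using g by auto
  let ?w = "\<lambda>\<omega>. std_normal_density (\<delta> * \<omega>)"
  define c where "c = (\<lambda>\<omega>. LINT t|lborel. g t * cos (\<omega> * t))"
  define s where "s = (\<lambda>\<omega>. LINT t|lborel. g t * sin (\<omega> * t))"
  \<comment> \<open>By the addition formula for the cosine, \<open>c \<omega>\<close> squared plus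
    \<open>s \<omega>\<close> squared is the integral of \<open>g t * k \<omega> t\<close>: the
    squared modulus becomes a double integral of real functions.\<close>
  define k where "k = (\<lambda>\<omega> t. LINT s|lborel. g s * cos (\<omega> * (t - s)))"
  have int_bd: "integrable lborel (\<lambda>t. g t * b t)" if "b \<in> borel_measurable borel" "\<And>t. \<bar>b t\<bar> \<le> 1" for b
    using that by (intro Bochner_Integration.integrable_bound[OF g]) (auto simp: abs_mult intro!: AE_I2
        mult_left_le)
  have ic: "integrable lborel (\<lambda>t. g t * cos (\<omega> * t))" and isn: "integrable lborel (\<lambda>t. g t * sin (\<omega> * t))"
      for \<omega>
    by (intro int_bd; simp)+
  have k_eq: "k \<omega> t = cos (\<omega> * t) * c \<omega> + sin (\<omega> * t) * s \<omega>" for \<omega> t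
  proof -
    have "k \<omega> t = (LINT x|lborel. cos (\<omega> * t) * (g x * cos (\<omega> * x)) + sin (\<omega> * t) * (g x * sin (\<omega> * x)))"
      unfolding k_def by (simp add: right_diff_distrib cos_diff algebra_simps)
    thus ?thesis using ic isn by (simp add: c_def s_def)
  qed
  define G where "G = (LINT s|lborel. \<bar>g s\<bar>)"
  have k_bound: "\<bar>k \<omega> t\<bar> \<le> G" for \<omega> t
  proof -
    have "\<bar>k \<omega> t\<bar> \<le> (LINT s|lborel. \<bar>g s * cos (\<omega> * (t - s))\<bar>)"
      unfolding k_def using integral_norm_bound[of lborel "\<lambda>s. g s * cos (\<omega> * (t - s))"] by simp
    also have "\<dots> \<le> G" unfolding G_def
      using g by (intro integral_mono integrable_abs int_bd) (auto simp: abs_mult intro!: mult_left_le)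
    finally show ?thesis .
  qed
  have [measurable]: "case_prod k \<in> borel_measurable (lborel \<Otimes>\<^sub>M lborel)"
    unfolding k_def by measurable
  have "(LINT \<omega>|lborel. ?w \<omega> * ((c \<omega>)\<^sup>2 + (s \<omega>)\<^sup>2)) = (LINT \<omega>|lborel. LINT t|lborel. ?w \<omega> * g t * k \<omega> t)"
  proof (rule Bochner_Integration.integral_cong[OF refl])
    fix \<omega>
    have "(c \<omega>)\<^sup>2 + (s \<omega>)\<^sup>2 = (LINT t|lborel. c \<omega> * (g t * cos (\<omega> * t)) + s \<omega> * (g t * sin (\<omega> * t)))"
      using ic isn by (simp add: c_def s_def power2_eq_square)
    also have "\<dots> = (LINT t|lborel. g t * k \<omega> t)" by (simp add: k_eq algebra_simps)
    finally show "?w \<omega> * ((c \<omega>)\<^sup>2 + (s \<omega>)\<^sup>2) = (LINT t|lborel. ?w \<omega> * g t * k \<omega> t)"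
      by (simp add: mult.assoc)
  qed
  also have "\<dots> = (LINT t|lborel. LINT \<omega>|lborel. ?w \<omega> * g t * k \<omega> t)"
    using integrable_pair_mult_bounded[OF integrable_scaled_std_normal[OF \<delta>] g, of "case_prod k" G] k_bound
    by (intro lborel_pair.Fubini_integral[symmetric]) auto
  also have "\<dots> = (LINT t|lborel. g t * (sqrt (2 * pi) * (LINT u|lborel. g (t - \<delta> * u) * std_normal_density u)))"
  proof (rule Bochner_Integration.integral_cong[OF refl])
    fix t
    have "(LINT \<omega>|lborel. ?w \<omega> * k \<omega> t) = (LINT \<omega>|lborel. LINT s|lborel. ?w \<omega> * g s * cos (\<omega> * (t - s)))"
      by (simp add: k_def mult.assoc)
    also have "\<dots> = (LINT s|lborel. LINT \<omega>|lborel. ?w \<omega> * g s * cos (\<omega> * (t - s)))"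
      using integrable_pair_mult_bounded[OF integrable_scaled_std_normal[OF \<delta>] g, of "\<lambda>(\<omega>, s). cos (\<omega> * (t
          - s))" 1]
      by (intro lborel_pair.Fubini_integral[symmetric]) (auto simp: case_prod_unfold)
    also have "\<dots> = (LINT s|lborel. g s * (LINT \<omega>|lborel. ?w \<omega> * cos (\<omega> * (t - s))))"
      by (simp add: ac_simps)
    also have "\<dots> = (LINT s|lborel. g s * (sqrt (2 * pi) / \<delta> * std_normal_density ((t - s) / \<delta>)))"
      by (simp add: integral_scaled_std_normal_cos[OF \<delta>])
    \<comment> \<open>Substitution \<open>s = t - \<delta> * u\<close>; its Jacobian cancels the
      factor \<open>1 / \<delta>\<close> of the Gaussian kernel.\<close>
    also have "\<dots> = \<bar>- \<delta>\<bar> *\<^sub>R (LINT u|lborel. g (t + - \<delta> * u) * (sqrt (2 * pi) / \<delta> * std_normal_density ((t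
        - (t + - \<delta> * u)) / \<delta>)))"
      using \<delta> by (intro lborel_integral_real_affine) auto
    also have "\<dots> = (LINT u|lborel. \<delta> * (g (t - \<delta> * u) * (sqrt (2 * pi) / \<delta> * std_normal_density u)))"
      using \<delta> by simp
    also have "\<dots> = (LINT u|lborel. sqrt (2 * pi) * (g (t - \<delta> * u) * std_normal_density u))"
      using \<delta> by (simp add: field_simps)
    finally have "(LINT \<omega>|lborel. ?w \<omega> * k \<omega> t) = sqrt (2 * pi) * (LINT u|lborel. g (t - \<delta> * u) *
        std_normal_density u)"
      by simp
    moreover have "(LINT \<omega>|lborel. ?w \<omega> * g t * k \<omega> t) = (LINT \<omega>|lborel. g t * (?w \<omega> * k \<omega> t))"
      by (simp add: ac_simps)
    ultimately show "(LINT \<omega>|lborel. ?w \<omega> * g t * k \<omega> t) = g t * (sqrt (2 * pi) * (LINT u|lborel. g (t - \<delta>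
        * u) * std_normal_density u))"
      by simp
  qed
  also have "\<dots> = sqrt (2 * pi) * (LINT t|lborel. g t * (LINT u|lborel. g (t - \<delta> * u) * std_normal_density u))"
    by (subst integral_mult_right_zero[symmetric]) (simp add: ac_simps)
  finally show ?thesis by (simp add: c_def s_def)
qed

text \<open>Both sides of the Gaussian identity are followed to \<delta> = 0. Monotone convergence
  on the frequency side presupposes no integrability of the spectrum; on the time side
  \<open>B\<close> supplies the majorant. Continuity is asked for only off 0, a null set, because
  the lemma is applied to a response that jumps when it is switched on at time 0.\<close>

lemma plancherel_real:
  fixes g :: "real \<Rightarrow> real"
  assumes g: "integrable lborel g" and bound: "\<And>t. \<bar>g t\<bar> \<le> B" and cont: "\<And>t. t \<noteq> 0 \<Longrightarrow> isCont g t"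
  shows "(\<integral>\<^sup>+\<omega>. ennreal ((LINT t|lborel. g t * cos (\<omega> * t))\<^sup>2 + (LINT t|lborel. g t * sin (\<omega> * t))\<^sup>2) \<partial>lborel) =
    ennreal (2 * pi) * (\<integral>\<^sup>+t. ennreal ((g t)\<^sup>2) \<partial>lborel)"
proof -
  have [measurable]: "g \<in> borel_measurable borel" using g by auto
  define p where "p = (\<lambda>\<omega>. (LINT t|lborel. g t * cos (\<omega> * t))\<^sup>2 + (LINT t|lborel. g t * sin (\<omega> * t))\<^sup>2)"
  define \<delta> where "\<delta> = (\<lambda>n. 1 / real (Suc n))"
  have \<delta>: "0 < \<delta> n" for n by (simp add: \<delta>_def)
  have \<delta>0: "\<delta> \<longlonglongrightarrow> 0" unfolding \<delta>_def by (rule LIMSEQ_Suc) (rule lim_1_over_n)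
  have p0: "0 \<le> p \<omega>" for \<omega> by (simp add: p_def)
  have [measurable]: "p \<in> borel_measurable borel" unfolding p_def by measurable
  have B: "0 \<le> B" using bound[of 0] by linarith
  define G where "G = (LINT s|lborel. \<bar>g s\<bar>)"
  have tr: "(LINT t|lborel. g t * b t)\<^sup>2 \<le> G\<^sup>2" if "b \<in> borel_measurable borel" "\<And>t. \<bar>b t\<bar> \<le> 1" for b
  proof (rule abs_le_square_iff[THEN iffD1])
    have i: "integrable lborel (\<lambda>t. g t * b t)"
      using that by (intro Bochner_Integration.integrable_bound[OF g]) (auto simp: abs_mult intro!: AE_I2
          mult_left_le)
    have "\<bar>LINT t|lborel. g t * b t\<bar> \<le> (LINT t|lborel. \<bar>g t * b t\<bar>)"
      using integral_norm_bound[of lborel "\<lambda>t. g t * b t"] by simp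
    also have "\<dots> \<le> G" unfolding G_def
      using g i that by (intro integral_mono integrable_abs) (auto simp: abs_mult intro!: mult_left_le)
    finally show "\<bar>LINT t|lborel. g t * b t\<bar> \<le> \<bar>G\<bar>" by linarith
  qed
  have p_le: "p \<omega> \<le> 2 * G\<^sup>2" for \<omega>
    unfolding p_def using tr[of "\<lambda>t. cos (\<omega> * t)"] tr[of "\<lambda>t. sin (\<omega> * t)"] by simp
  let ?l = "\<lambda>n. LINT \<omega>|lborel. std_normal_density (\<delta> n * \<omega>) * p \<omega>"
  have nn: "(\<integral>\<^sup>+\<omega>. ennreal (std_normal_density (\<delta> n * \<omega>) * p \<omega>) \<partial>lborel) = ennreal (?l n)" for n
  proof (rule nn_integral_eq_integral)
    show "integrable lborel (\<lambda>\<omega>. std_normal_density (\<delta> n * \<omega>) * p \<omega>)"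
      by (rule Bochner_Integration.integrable_bound[OF integrable_mult_left[OF
          integrable_scaled_std_normal[OF \<delta>[of n]], of "2 * G\<^sup>2"]])
        (use p_le p0 in \<open>auto simp: abs_mult intro!: AE_I2 mult_left_mono\<close>)
  qed (use p0 in auto)
  have "(\<lambda>n. \<integral>\<^sup>+\<omega>. ennreal (std_normal_density (\<delta> n * \<omega>) * p \<omega>) \<partial>lborel) \<longlonglongrightarrow>
      (\<integral>\<^sup>+\<omega>. ennreal (std_normal_density 0 * p \<omega>) \<partial>lborel)"
  proof (rule nn_integral_LIMSEQ)
    show "incseq (\<lambda>n \<omega>. ennreal (std_normal_density (\<delta> n * \<omega>) * p \<omega>))"
    proof (intro incseq_SucI le_funI ennreal_leI mult_right_mono p0)
      fix n \<omega>
      have "(\<delta> (Suc n))\<^sup>2 \<le> (\<delta> n)\<^sup>2" unfolding \<delta>_def by (intro power_mono divide_left_mono) auto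
      hence "(\<delta> (Suc n) * \<omega>)\<^sup>2 \<le> (\<delta> n * \<omega>)\<^sup>2" by (simp add: power_mult_distrib mult_right_mono)
      thus "std_normal_density (\<delta> n * \<omega>) \<le> std_normal_density (\<delta> (Suc n) * \<omega>)"
        by (simp add: std_normal_density_def mult_left_mono divide_right_mono)
    qed
    fix \<omega>
    have "(\<lambda>n. std_normal_density (\<delta> n * \<omega>) * p \<omega>) \<longlonglongrightarrow> std_normal_density (0 * \<omega>) * p \<omega>"
      unfolding std_normal_density_def by (intro tendsto_intros \<delta>0) auto
    thus "(\<lambda>n. ennreal (std_normal_density (\<delta> n * \<omega>) * p \<omega>)) \<longlonglongrightarrow> ennreal (std_normal_density 0 * p \<omega>)"
      by (intro tendsto_ennrealI) simp
  qed auto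
  moreover have "?l \<longlonglongrightarrow> sqrt (2 * pi) * (LINT t|lborel. g t * g t)"
  proof -
    have phi: "integrable lborel std_normal_density" "(LINT u|lborel. std_normal_density u) = 1"
      using integrable_std_normal_moment[of 0] integral_std_normal_moment_even[of 0] by auto
    have inner: "(\<lambda>n. LINT u|lborel. g (t - \<delta> n * u) * std_normal_density u) \<longlonglongrightarrow> g t" if "t \<noteq> 0" for t
    proof -
      have "(\<lambda>n. LINT u|lborel. g (t - \<delta> n * u) * std_normal_density u) \<longlonglongrightarrow> (LINT u|lborel. g t *
          std_normal_density u)"
      proof (rule integral_dominated_convergence[where w = "\<lambda>u. B * std_normal_density u"])
        show "AE u in lborel. (\<lambda>n. g (t - \<delta> n * u) * std_normal_density u) \<longlonglongrightarrow> g t * std_normal_density u"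
        proof (intro AE_I2 tendsto_mult tendsto_const)
          fix u
          have "(\<lambda>n. t - \<delta> n * u) \<longlonglongrightarrow> t - 0 * u" by (intro tendsto_intros \<delta>0)
          thus "(\<lambda>n. g (t - \<delta> n * u)) \<longlonglongrightarrow> g t" using isCont_tendsto_compose[OF cont[OF that]] by simp
        qed
        show "AE u in lborel. norm (g (t - \<delta> n * u) * std_normal_density u) \<le> B * std_normal_density u" for n
          by (auto simp: abs_mult intro!: AE_I2 mult_right_mono bound)
      qed (use phi in auto)
      thus ?thesis by (simp add: phi(2))
    qed
    have "(\<lambda>n. LINT t|lborel. g t * (LINT u|lborel. g (t - \<delta> n * u) * std_normal_density u)) \<longlonglongrightarrow> (LINT
        t|lborel. g t * g t)"
    proof (rule integral_dominated_convergence[where w = "\<lambda>t. \<bar>g t\<bar> * B"])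
      have "AE t in lborel. t \<noteq> (0::real)" by (rule AE_lborel_singleton)
      thus "AE t in lborel. (\<lambda>n. g t * (LINT u|lborel. g (t - \<delta> n * u) * std_normal_density u)) \<longlonglongrightarrow> g t * g t"
        by eventually_elim (intro tendsto_mult tendsto_const inner)
      show "AE t in lborel. norm (g t * (LINT u|lborel. g (t - \<delta> n * u) * std_normal_density u)) \<le> \<bar>g t\<bar> *
          B" for n
      proof (intro AE_I2)
        fix t
        have i: "integrable lborel (\<lambda>u. g (t - \<delta> n * u) * std_normal_density u)"
          by (rule Bochner_Integration.integrable_bound[OF integrable_mult_right[OF phi(1), of B]])
            (use bound B in \<open>auto simp: abs_mult intro!: AE_I2 mult_right_mono\<close>)
        have "\<bar>LINT u|lborel. g (t - \<delta> n * u) * std_normal_density u\<bar> \<le>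
            (LINT u|lborel. \<bar>g (t - \<delta> n * u) * std_normal_density u\<bar>)"
          using integral_norm_bound[of lborel "\<lambda>u. g (t - \<delta> n * u) * std_normal_density u"] by simp
        also have "\<dots> \<le> (LINT u|lborel. B * std_normal_density u)"
          using phi i by (intro integral_mono integrable_abs) (auto simp: abs_mult intro!: mult_right_mono
              bound)
        also have "\<dots> = B" by (simp add: phi(2))
        finally show "norm (g t * (LINT u|lborel. g (t - \<delta> n * u) * std_normal_density u)) \<le> \<bar>g t\<bar> * B"
          by (simp add: abs_mult mult_left_mono)
      qed
      show "integrable lborel (\<lambda>t. \<bar>g t\<bar> * B)" using g by simp
    qed measurable
    thus ?thesis
      unfolding p_def plancherel_gaussian[OF g \<delta>] by (intro tendsto_mult tendsto_const)
  qed
  hence "(\<lambda>n. ennreal (?l n)) \<longlonglongrightarrow> ennreal (sqrt (2 * pi) * (LINT t|lborel. g t * g t))"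
    by (rule tendsto_ennrealI)
  ultimately have eq: "(\<integral>\<^sup>+\<omega>. ennreal (std_normal_density 0 * p \<omega>) \<partial>lborel) =
      ennreal (sqrt (2 * pi) * (LINT t|lborel. g t * g t))"
    unfolding nn by (rule LIMSEQ_unique)
  have int: "integrable lborel (\<lambda>t. g t * g t)"
    by (rule Bochner_Integration.integrable_bound[OF integrable_mult_right[OF g, of B]])
      (use mult_right_mono[OF bound abs_ge_zero] B in \<open>auto simp: abs_mult simp del: abs_mult_self_eq
          intro!: AE_I2\<close>)
  \<comment> \<open>One factor \<open>sqrt (2 * pi)\<close> undoes the limiting weight
    \<open>std_normal_density 0\<close>; together with the one on the time side it produces the
    constant \<open>2 * pi\<close>.\<close>
  have c0: "sqrt (2 * pi) * std_normal_density 0 = 1" by (simp add: std_normal_density_def)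
  have "(\<integral>\<^sup>+\<omega>. ennreal (p \<omega>) \<partial>lborel) =
      (\<integral>\<^sup>+\<omega>. ennreal (sqrt (2 * pi)) * ennreal (std_normal_density 0 * p \<omega>) \<partial>lborel)"
    using p0 by (simp add: ennreal_mult[symmetric] mult.assoc[symmetric] c0)
  also have "\<dots> = ennreal (sqrt (2 * pi)) * ennreal (sqrt (2 * pi) * (LINT t|lborel. g t * g t))"
    by (simp add: nn_integral_cmult eq)
  also have "\<dots> = ennreal (2 * pi) * ennreal (LINT t|lborel. g t * g t)"
    by (simp add: ennreal_mult'[symmetric] mult.assoc[symmetric])
  also have "ennreal (LINT t|lborel. g t * g t) = (\<integral>\<^sup>+t. ennreal (g t * g t) \<partial>lborel)"
    by (rule nn_integral_eq_integral[symmetric]) (use int in auto)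
  finally show ?thesis by (simp add: p_def power2_eq_square)
qed

section \<open>The matrix exponential\<close>

lemma bounded_bilinear_matrix_mult:
  "bounded_bilinear ((**) :: real^'n^'m \<Rightarrow> real^'k^'n \<Rightarrow> real^'k^'m)"
  by (rule bilinear_conv_bounded_bilinear[THEN iffD1])
    (auto simp: bilinear_def matrix_matrix_mult_def vec_eq_iff sum.distrib algebra_simps sum_distrib_left
      intro!: linearI)

global_interpretation matmul: bounded_bilinear "(**) :: real^'n^'m \<Rightarrow> real^'k^'n \<Rightarrow> real^'k^'m"
  by (rule bounded_bilinear_matrix_mult)

lemma bounded_bilinear_matrix_vector_mult:
  "bounded_bilinear ((*v) :: real^'n^'m \<Rightarrow> real^'n \<Rightarrow> real^'m)"
  by (rule bilinear_conv_bounded_bilinear[THEN iffD1])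
    (auto simp: bilinear_def matrix_vector_mult_def vec_eq_iff sum.distrib algebra_simps sum_distrib_left
      intro!: linearI)

global_interpretation matvec: bounded_bilinear "(*v) :: real^'n^'m \<Rightarrow> real^'n \<Rightarrow> real^'m"
  by (rule bounded_bilinear_matrix_vector_mult)

lemma bounded_linear_transpose:
  "bounded_linear (transpose :: real^'n^'m \<Rightarrow> real^'m^'n)"
  by (rule linear_conv_bounded_linear[THEN iffD1])
    (auto simp: transpose_def vec_eq_iff intro!: linearI)

lemma has_vector_derivative_vecI:
  fixes f :: "real \<Rightarrow> 'a::euclidean_space ^ 'n"
  assumes "\<And>i. ((\<lambda>x. f x $ i) has_vector_derivative f' $ i) (at x within S)"
  shows "(f has_vector_derivative f') (at x within S)"
  unfolding has_vector_derivative_def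
proof (subst has_derivative_componentwise_within, intro ballI)
  fix b :: "'a^'n" assume "b \<in> Basis"
  then obtain i u where b: "b = axis i u" by (auto simp: Basis_vec_def)
  show "((\<lambda>x. f x \<bullet> b) has_derivative (\<lambda>y. (y *\<^sub>R f') \<bullet> b)) (at x within S)"
    using has_derivative_inner_left[OF assms[of i, unfolded has_vector_derivative_def], of u]
    by (simp add: b inner_axis)
qed

abbreviation mpow :: "real^'n^'n \<Rightarrow> nat \<Rightarrow> real^'n^'n" where
  "mpow A k \<equiv> ((**) A ^^ k) (mat 1)"

lemma mpow_commute: "A ** mpow A k = mpow A k ** A"
  by (induction k) (simp_all, metis matrix_mul_assoc)

lemma mpow_scaleR: "mpow (t *\<^sub>R A) k = t ^ k *\<^sub>R mpow A k"
  by (induction k) (simp_all add: matmul.scaleR_left matmul.scaleR_right)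

text \<open>With the constant \<open>K\<close> of the bounded bilinear product, norms of powers grow
  at most geometrically, so a real exponential series is a majorant.\<close>

lemma summable_matrix_exp:
  fixes A :: "real^'n^'n"
  shows "summable (\<lambda>k. (1 / fact k) *\<^sub>R mpow A k)"
proof -
  obtain K where K: "\<And>(A :: real^'n^'n) (B :: real^'n^'n). norm (A ** B) \<le> norm A * norm B * K"
    using matmul.bounded by metis
  have "norm (mpow A k) \<le> (norm A * \<bar>K\<bar>) ^ k * norm (mat 1 :: real^'n^'n)" for k
  proof (induction k)
    case (Suc k)
    have "norm (mpow A (Suc k)) \<le> norm A * norm (mpow A k) * K"
      using K[of A "mpow A k"] by simp
    also have "\<dots> \<le> norm A * norm (mpow A k) * \<bar>K\<bar>"
      by (intro mult_left_mono) auto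
    also have "\<dots> \<le> norm A * ((norm A * \<bar>K\<bar>) ^ k * norm (mat 1 :: real^'n^'n)) * \<bar>K\<bar>"
      by (intro mult_left_mono mult_right_mono Suc) auto
    finally show ?case by (simp add: ac_simps)
  qed simp
  hence "norm ((1 / fact k) *\<^sub>R mpow A k)
      \<le> norm (mat 1 :: real^'n^'n) * (inverse (fact k) *\<^sub>R (norm A * \<bar>K\<bar>) ^ k)" for k
    by (simp add: divide_simps mult.commute)
  moreover have "summable (\<lambda>k. norm (mat 1 :: real^'n^'n) * (inverse (fact k) *\<^sub>R (norm A * \<bar>K\<bar>) ^ k))"
    by (intro summable_mult summable_exp_generic)
  ultimately show ?thesis by (rule summable_comparison_test'[rotated])
qed

lemma matrix_exp_sums: "(\<lambda>k. (1 / fact k) *\<^sub>R mpow A k) sums matrix_exp A"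
  unfolding matrix_exp_def by (rule summable_sums[OF summable_matrix_exp])

text \<open>In this form each entry is a scalar power series in \<open>t\<close> with fixed
  coefficients, to which termwise differentiation applies.\<close>

lemma matrix_exp_entry_sums:
  "(\<lambda>k. mpow A k $ i $ j / fact k * t ^ k) sums (matrix_exp (t *\<^sub>R A) $ i $ j)"
proof -
  have "(\<lambda>k. ((1 / fact k) *\<^sub>R mpow (t *\<^sub>R A) k) $ i $ j) sums (matrix_exp (t *\<^sub>R A) $ i $ j)"
    by (intro bounded_linear.sums[OF bounded_linear_vec_nth] matrix_exp_sums)
  thus ?thesis by (simp add: mpow_scaleR ac_simps)
qed

lemma matrix_exp_0 [simp]: "matrix_exp (0 :: real^'n^'n) = mat 1"
proof -
  have "mpow (0 :: real^'n^'n) k = (if k = 0 then mat 1 else 0)" for k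
    by (cases k) (auto simp: matmul.zero_left)
  hence "(\<lambda>k. (1 / fact k) *\<^sub>R mpow (0 :: real^'n^'n) k) = (\<lambda>k. if k = 0 then mat 1 else 0)"
    by auto
  hence "(\<lambda>k. if k = 0 then mat 1 else 0) sums matrix_exp (0 :: real^'n^'n)"
    using matrix_exp_sums[of "0 :: real^'n^'n"] by (simp only:)
  with sums_single[of 0 "\<lambda>_. mat 1 :: real^'n^'n"] show ?thesis
    using sums_unique2 by blast
qed

lemma matrix_exp_commute: "A ** matrix_exp (t *\<^sub>R A) = matrix_exp (t *\<^sub>R A) ** A"
proof (rule sums_unique2)
  show "(\<lambda>k. A ** ((1 / fact k) *\<^sub>R mpow (t *\<^sub>R A) k)) sums (A ** matrix_exp (t *\<^sub>R A))"
    by (intro bounded_linear.sums[OF matmul.bounded_linear_right] matrix_exp_sums)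
  have "(\<lambda>k. ((1 / fact k) *\<^sub>R mpow (t *\<^sub>R A) k) ** A) sums (matrix_exp (t *\<^sub>R A) ** A)"
    by (intro bounded_linear.sums[OF matmul.bounded_linear_left] matrix_exp_sums)
  moreover have "A ** ((1 / fact k) *\<^sub>R mpow (t *\<^sub>R A) k) = ((1 / fact k) *\<^sub>R mpow (t *\<^sub>R A) k) ** A" for k
    by (simp add: mpow_scaleR matmul.scaleR_left matmul.scaleR_right mpow_commute)
  ultimately show "(\<lambda>k. A ** ((1 / fact k) *\<^sub>R mpow (t *\<^sub>R A) k)) sums (matrix_exp (t *\<^sub>R A) ** A)"
    by simp
qed

lemma matrix_exp_has_vector_derivative:
  "((\<lambda>t. matrix_exp (t *\<^sub>R A)) has_vector_derivative A ** matrix_exp (t *\<^sub>R A)) (at t within S)"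
proof (intro has_vector_derivative_vecI)
  fix i j
  let ?c = "\<lambda>k. mpow A k $ i $ j / fact k"
  have "((\<lambda>t. \<Sum>k. ?c k * t ^ k) has_field_derivative (\<Sum>k. diffs ?c k * t ^ k)) (at t)"
    by (intro termdiffs_strong_converges_everywhere sums_summable[OF matrix_exp_entry_sums])
  moreover have "(\<Sum>k. ?c k * t ^ k) = matrix_exp (t *\<^sub>R A) $ i $ j" for t
    by (rule sums_unique[OF matrix_exp_entry_sums, symmetric])
  moreover have "(\<Sum>k. diffs ?c k * t ^ k) = (A ** matrix_exp (t *\<^sub>R A)) $ i $ j"
  proof -
    have "(\<lambda>k. (A ** ((1 / fact k) *\<^sub>R mpow (t *\<^sub>R A) k)) $ i $ j) sums
        ((A ** matrix_exp (t *\<^sub>R A)) $ i $ j)"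
      by (intro bounded_linear.sums[OF bounded_linear_vec_nth]
          bounded_linear.sums[OF matmul.bounded_linear_right] matrix_exp_sums)
    \<comment> \<open>\<open>diffs\<close> shifts the coefficients:
      \<open>Suc k / fact (Suc k)\<close> collapses to \<open>1 / fact k\<close>, and the additional
      factor of \<open>mpow A (Suc k)\<close> is the \<open>A\<close> in front.\<close>
    moreover have "(A ** ((1 / fact k) *\<^sub>R mpow (t *\<^sub>R A) k)) $ i $ j = diffs ?c k * t ^ k" for k
      by (simp add: diffs_def mpow_scaleR matmul.scaleR_right del: of_nat_Suc)
    ultimately have "(\<lambda>k. diffs ?c k * t ^ k) sums ((A ** matrix_exp (t *\<^sub>R A)) $ i $ j)"
      by (simp only:)
    from sums_unique[OF this] show ?thesis ..
  qed
  ultimately have "((\<lambda>t. matrix_exp (t *\<^sub>R A) $ i $ j) has_field_derivative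
      (A ** matrix_exp (t *\<^sub>R A)) $ i $ j) (at t)"
    by simp
  thus "((\<lambda>t. matrix_exp (t *\<^sub>R A) $ i $ j) has_vector_derivative
      (A ** matrix_exp (t *\<^sub>R A)) $ i $ j) (at t within S)"
    by (meson has_real_derivative_iff_has_vector_derivative has_vector_derivative_at_within)
qed

lemma continuous_on_matrix_exp [continuous_intros]:
  "continuous_on S (\<lambda>t. matrix_exp (t *\<^sub>R A))"
  using matrix_exp_has_vector_derivative has_vector_derivative_continuous
  by (metis continuous_on_eq_continuous_within)

text \<open>The product of \<open>matrix_exp (t *\<^sub>R (- A))\<close> with a solution has
  derivative zero. Applied to the exponential itself this shows that the two exponentials are
  mutually inverse, so the solution can be isolated. The semigroup law, transposes and scalar shifts
  then follow by checking a differential equation.\<close>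

lemma matrix_ode_unique:
  fixes A X
  assumes "\<And>t. (X has_vector_derivative A ** X t) (at t)"
  shows "X t = matrix_exp (t *\<^sub>R A) ** X 0"
proof -
  have *: "matrix_exp (t *\<^sub>R (- A)) ** X t = X 0" if "\<And>t. (X has_vector_derivative A ** X t) (at t)" for X t
  proof -
    have "((\<lambda>t. matrix_exp (t *\<^sub>R (- A)) ** X t) has_vector_derivative 0) (at t)" for t
    proof -
      have "((\<lambda>t. matrix_exp (t *\<^sub>R (- A)) ** X t) has_vector_derivative
          matrix_exp (t *\<^sub>R (- A)) ** (A ** X t) + (- A ** matrix_exp (t *\<^sub>R (- A))) ** X t) (at t)"
        by (intro matmul.has_vector_derivative matrix_exp_has_vector_derivative that)
      also have "matrix_exp (t *\<^sub>R (- A)) ** (A ** X t) + (- A ** matrix_exp (t *\<^sub>R (- A))) ** X t = 0"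
        unfolding matrix_exp_commute
        by (simp add: matrix_mul_assoc matmul.minus_right matmul.minus_left)
      finally show ?thesis .
    qed
    then obtain c where c: "\<And>t. matrix_exp (t *\<^sub>R (- A)) ** X t = c"
      using has_vector_derivative_zero_constant[of UNIV "\<lambda>t. matrix_exp (t *\<^sub>R (- A)) ** X t"] by auto
    from c[of t] c[of 0] show ?thesis by simp
  qed
  have "matrix_exp (t *\<^sub>R (- A)) ** matrix_exp (t *\<^sub>R A) = mat 1"
    using *[OF matrix_exp_has_vector_derivative, of t] by simp
  hence "matrix_exp (t *\<^sub>R A) ** matrix_exp (t *\<^sub>R (- A)) = mat 1"
    by (simp add: matrix_left_right_inverse)
  thus ?thesis using *[OF assms, of t] by (metis matrix_mul_assoc matrix_mul_lid)
qed

lemma matrix_exp_eqI: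
  assumes "\<And>t. (X has_vector_derivative A ** X t) (at t)" "X 0 = mat 1"
  shows "matrix_exp (t *\<^sub>R A) = X t"
  using matrix_ode_unique[OF assms(1)] assms(2) by simp

lemma matrix_exp_add:
  "matrix_exp ((s + t) *\<^sub>R A) = matrix_exp (s *\<^sub>R A) ** matrix_exp (t *\<^sub>R A)"
proof -
  have "((\<lambda>s. matrix_exp ((s + t) *\<^sub>R A)) has_vector_derivative A ** matrix_exp ((s + t) *\<^sub>R A)) (at s)" for s
    using vector_diff_chain_at[of "\<lambda>s. s + t" 1 s "\<lambda>t. matrix_exp (t *\<^sub>R A)",
        OF _ matrix_exp_has_vector_derivative]
    by (simp add: o_def has_vector_derivative_add_const)
  from matrix_ode_unique[OF this, of s] show ?thesis by simp
qed

lemma matrix_exp_transpose: "matrix_exp (t *\<^sub>R transpose A) = transpose (matrix_exp (t *\<^sub>R A))"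
proof (rule matrix_exp_eqI)
  show "((\<lambda>t. transpose (matrix_exp (t *\<^sub>R A))) has_vector_derivative
      transpose A ** transpose (matrix_exp (t *\<^sub>R A))) (at t)" for t
    using bounded_linear.has_vector_derivative[OF bounded_linear_transpose
        matrix_exp_has_vector_derivative[of A t UNIV]]
    by (simp add: matrix_exp_commute matrix_transpose_mul)
qed simp

lemma matrix_exp_shift:
  "matrix_exp (t *\<^sub>R (B - c *\<^sub>R mat 1)) = exp (- (c * t)) *\<^sub>R matrix_exp (t *\<^sub>R B)"
proof (rule matrix_exp_eqI)
  fix t :: real
  have "((\<lambda>t. exp (- (c * t)) *\<^sub>R matrix_exp (t *\<^sub>R B)) has_vector_derivative
      exp (- (c * t)) *\<^sub>R (B ** matrix_exp (t *\<^sub>R B)) + (- c * exp (- (c * t))) *\<^sub>R matrix_exp (t *\<^sub>R B))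
          (at t)"
    by (intro has_vector_derivative_scaleR matrix_exp_has_vector_derivative) (auto intro!: derivative_eq_intros)
  thus "((\<lambda>t. exp (- (c * t)) *\<^sub>R matrix_exp (t *\<^sub>R B)) has_vector_derivative
      (B - c *\<^sub>R mat 1) ** (exp (- (c * t)) *\<^sub>R matrix_exp (t *\<^sub>R B))) (at t)"
    by (simp add: matmul.diff_left matmul.scaleR_left matmul.scaleR_right scaleR_diff_right ac_simps)
qed simp

lemma matrix_exp_kernel:
  assumes "A *v x = 0"
  shows "matrix_exp (t *\<^sub>R A) *v x = x"
proof -
  have "((\<lambda>t. matrix_exp (t *\<^sub>R A) *v x) has_vector_derivative 0) (at t)" for t
    using bounded_linear.has_vector_derivative[OF matvec.bounded_linear_left
        matrix_exp_has_vector_derivative[of A t UNIV], of x]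
    by (simp add: matrix_exp_commute matrix_vector_mul_assoc[symmetric] assms)
  then obtain c where c: "\<And>t. matrix_exp (t *\<^sub>R A) *v x = c"
    using has_vector_derivative_zero_constant[of UNIV "\<lambda>t. matrix_exp (t *\<^sub>R A) *v x"] by auto
  from c[of t] c[of 0] show ?thesis by simp
qed

section \<open>Exponentials of Z-matrices with zero row sums\<close>

text \<open>From here on the semigroup is written \<open>matrix_exp (t *\<^sub>R (- A))\<close>; the
  simp rule would pull the sign out and prevent the lemmas from matching.\<close>

declare scaleR_minus_right [simp del]

text \<open>The negative of such a matrix is the generator of a finite continuous-time Markov chain.
  Laplacians have both properties and the reduction preserves them, so one theory serves the full
  and the reduced system.\<close>

definition zero_row_sum_Z_matrix :: "real^'n^'n \<Rightarrow> bool" where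
  "zero_row_sum_Z_matrix A \<longleftrightarrow> A *v 1 = 0 \<and> (\<forall>i j. i \<noteq> j \<longrightarrow> A $ i $ j \<le> 0)"

lemma zero_row_sumD:
  assumes "zero_row_sum_Z_matrix A"
  shows "(\<Sum>j\<in>UNIV. A $ i $ j) = 0"
proof -
  have "(A *v 1) $ i = 0" using assms by (simp add: zero_row_sum_Z_matrix_def)
  thus ?thesis by (simp add: matrix_vector_mult_def)
qed

lemma Z_matrixD:
  assumes "zero_row_sum_Z_matrix A" "i \<noteq> j"
  shows "A $ i $ j \<le> 0"
  using assms by (simp add: zero_row_sum_Z_matrix_def)

text \<open>The form needed for maximum principles: where \<open>y\<close> has an extremum, all
  summands have the same sign.\<close>

lemma zero_row_sum_mult_vec:
  assumes "zero_row_sum_Z_matrix A"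
  shows "(A *v y) $ i = (\<Sum>j\<in>UNIV. A $ i $ j * (y $ j - y $ i))"
  using zero_row_sumD[OF assms, of i]
  by (simp add: matrix_vector_mult_def right_diff_distrib sum_subtractf flip: sum_distrib_right)

text \<open>Diagonal pairs may be included, since only the reflexive transitive closure is
  used.\<close>

definition depends_on :: "real^'n^'n \<Rightarrow> ('n \<times> 'n) set" where
  "depends_on A = {(i, j). A $ i $ j \<noteq> 0}"

section \<open>Positivity and averaging properties of the semigroup\<close>

lemma mpow_nonneg:
  assumes "\<And>i j. 0 \<le> B $ i $ j"
  shows "0 \<le> mpow B k $ i $ j"
  by (induction k arbitrary: i j) (auto simp: mat_def matrix_matrix_mult_def assms intro!: sum_nonneg)

text \<open>All terms of the series are nonnegative, so one of them is a lower bound; the terms 0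
  and 1 will give strict positivity on the diagonal and along edges.\<close>

lemma matrix_exp_nonneg_ge_term:
  assumes "\<And>i j. 0 \<le> B $ i $ j" "0 \<le> t"
  shows "mpow B k $ i $ j / fact k * t ^ k \<le> matrix_exp (t *\<^sub>R B) $ i $ j"
proof -
  let ?f = "\<lambda>k. mpow B k $ i $ j / fact k * t ^ k"
  have "sum ?f {k} \<le> suminf ?f"
    by (intro sum_le_suminf sums_summable[OF matrix_exp_entry_sums])
      (use assms in \<open>auto intro!: mult_nonneg_nonneg divide_nonneg_nonneg mpow_nonneg\<close>)
  thus ?thesis unfolding sums_unique[OF matrix_exp_entry_sums, symmetric] by simp
qed

text \<open>Up to the scalar factor \<open>exp (- d * t)\<close>, the semigroup is the exponential of a nonnegative matrix.\<close>

lemma matrix_exp_Z_matrix_entries: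
  assumes A: "zero_row_sum_Z_matrix A" and t: "0 \<le> t"
  shows "0 \<le> matrix_exp (t *\<^sub>R (- A)) $ i $ j"
    and "0 < matrix_exp (t *\<^sub>R (- A)) $ i $ i"
    and "\<lbrakk>A $ i $ j \<noteq> 0; 0 < t\<rbrakk> \<Longrightarrow> 0 < matrix_exp (t *\<^sub>R (- A)) $ i $ j"
proof -
  \<comment> \<open>Any upper bound of the diagonal would do as a shift; the sum of absolute values
    dominates each entry.\<close>
  define d where "d = (\<Sum>i\<in>UNIV. \<bar>A $ i $ i\<bar>)"
  define B where "B = d *\<^sub>R mat 1 - A"
  have d: "A $ i $ i \<le> d" for i
  proof -
    have "\<bar>A $ i $ i\<bar> \<le> d" unfolding d_def by (rule member_le_sum) auto
    thus ?thesis by simp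
  qed
  have B: "0 \<le> B $ i $ j" for i j
    using d[of i] Z_matrixD[OF A, of i j] by (auto simp: B_def mat_def)
  have "- A = B - d *\<^sub>R mat 1" by (simp add: B_def)
  hence eq: "matrix_exp (t *\<^sub>R (- A)) = exp (- (d * t)) *\<^sub>R matrix_exp (t *\<^sub>R B)"
    by (simp add: matrix_exp_shift)
  note ge = matrix_exp_nonneg_ge_term[OF B t]
  show "0 \<le> matrix_exp (t *\<^sub>R (- A)) $ i $ j" for i j
    using ge[of 0 i j] by (auto simp: eq mat_def split: if_splits)
  show diag: "0 < matrix_exp (t *\<^sub>R (- A)) $ i $ i" for i
    using ge[of 0 i i] by (simp add: eq mat_def)
  show "0 < matrix_exp (t *\<^sub>R (- A)) $ i $ j" if "A $ i $ j \<noteq> 0" "0 < t"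
  proof (cases "i = j")
    case False
    hence "0 < B $ i $ j" using that Z_matrixD[OF A, of i j] by (simp add: B_def mat_def)
    hence "0 < B $ i $ j * t" using that by simp
    also have "\<dots> \<le> matrix_exp (t *\<^sub>R B) $ i $ j" using ge[of 1 i j] by simp
    finally show ?thesis by (simp add: eq)
  qed (use diag in simp)
qed

text \<open>Induction along a dependence path. The time is split into halves, and in the resulting
  matrix product a single summand, through the last intermediate vertex, is already positive.
  Halving at each edge is why the time stays arbitrary in the induction.\<close>

lemma matrix_exp_Z_matrix_pos:
  assumes A: "zero_row_sum_Z_matrix A" and "(i, j) \<in> (depends_on A)\<^sup>*" "0 < t"
  shows "0 < matrix_exp (t *\<^sub>R (- A)) $ i $ j"
  using assms(2,3)
proof (induction arbitrary: t)
  case base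
  thus ?case using matrix_exp_Z_matrix_entries(2)[OF A, of t i] by simp
next
  case (step j k)
  let ?T = "matrix_exp ((t/2) *\<^sub>R (- A))"
  have "0 < ?T $ i $ j * ?T $ j $ k"
    using step matrix_exp_Z_matrix_entries(3)[OF A, of "t/2" j k] by (auto simp: depends_on_def)
  also have "\<dots> \<le> (\<Sum>l\<in>UNIV. ?T $ i $ l * ?T $ l $ k)"
    by (rule member_le_sum) (use step.prems in \<open>auto intro!: mult_nonneg_nonneg
        matrix_exp_Z_matrix_entries(1)[OF A]\<close>)
  also have "\<dots> = matrix_exp ((t/2 + t/2) *\<^sub>R (- A)) $ i $ k"
    unfolding matrix_exp_add by (simp add: matrix_matrix_mult_def)
  finally show ?case by simp
qed

lemma matrix_exp_row_sum:
  assumes "zero_row_sum_Z_matrix A"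
  shows "(\<Sum>j\<in>UNIV. matrix_exp (t *\<^sub>R (- A)) $ i $ j) = 1"
proof -
  have "(- A) *v 1 = 0" using assms by (simp add: zero_row_sum_Z_matrix_def matvec.minus_left)
  from matrix_exp_kernel[OF this, of t] have "(matrix_exp (t *\<^sub>R (- A)) *v 1) $ i = 1" by simp
  thus ?thesis by (simp add: matrix_vector_mult_def)
qed

text \<open>Rows of the semigroup are probability vectors, so each coordinate of the image is a
  weighted average of those of \<open>x\<close>.\<close>

lemma matrix_exp_le:
  assumes A: "zero_row_sum_Z_matrix A" and "0 \<le> t" "\<And>j. x $ j \<le> c"
  shows "(matrix_exp (t *\<^sub>R (- A)) *v x) $ i \<le> c"
proof -
  let ?T = "matrix_exp (t *\<^sub>R (- A))"
  have "(?T *v x) $ i = (\<Sum>j\<in>UNIV. ?T $ i $ j * x $ j)" by (simp add: matrix_vector_mult_def)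
  also have "\<dots> \<le> (\<Sum>j\<in>UNIV. ?T $ i $ j * c)"
    using assms by (intro sum_mono mult_left_mono matrix_exp_Z_matrix_entries(1)) auto
  also have "\<dots> = c" using matrix_exp_row_sum[OF A, of t i] by (simp flip: sum_distrib_right)
  finally show ?thesis .
qed

text \<open>
  If a coordinate of \<open>T(1) x\<close> attains an upper bound \<open>c\<close> of \<open>x\<close>, then \<open>x\<close> equals \<open>c\<close> on all
  vertices on which the coordinate depends; at a minimum of \<open>y\<close> over these vertices, \<open>A y\<close> is not positive.
\<close>

lemma matrix_exp_range_attained:
  assumes A: "zero_row_sum_Z_matrix A" and x: "x = A *v y" and le: "\<And>j. x $ j \<le> c"
    and eq: "(matrix_exp (1 *\<^sub>R (- A)) *v x) $ i = c"
  shows "c \<le> 0"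
proof -
  let ?T = "matrix_exp (1 *\<^sub>R (- A))"
  define S where "S = {j. (i, j) \<in> (depends_on A)\<^sup>*}"
  have "(\<Sum>j\<in>UNIV. ?T $ i $ j * (c - x $ j)) = (\<Sum>j\<in>UNIV. ?T $ i $ j) * c - (?T *v x) $ i"
    by (simp add: matrix_vector_mult_def algebra_simps sum_subtractf sum_distrib_left)
  also have "\<dots> = 0" using matrix_exp_row_sum[OF A, of 1 i] eq by simp
  finally have "(\<Sum>j\<in>UNIV. ?T $ i $ j * (c - x $ j)) = 0" .
  hence "\<forall>j\<in>UNIV. ?T $ i $ j * (c - x $ j) = 0"
    by (subst (asm) sum_nonneg_eq_0_iff)
      (auto intro!: mult_nonneg_nonneg matrix_exp_Z_matrix_entries(1)[OF A, of 1, simplified] simp: le)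
  \<comment> \<open>An average equals an upper bound only if the bound is attained wherever the
    weight is positive, that is, on all of \<open>S\<close>.\<close>
  hence xc: "x $ j = c" if "j \<in> S" for j
    using matrix_exp_Z_matrix_pos[OF A, of i j 1] that by (force simp: S_def)
  have "i \<in> S" by (simp add: S_def)
  hence "Min ((\<lambda>j. y $ j) ` S) \<in> (\<lambda>j. y $ j) ` S" by (intro Min_in) auto
  then obtain m where m: "m \<in> S" "y $ m = Min ((\<lambda>j. y $ j) ` S)" by auto
  have min: "y $ m \<le> y $ k" if "k \<in> S" for k using that m by (auto intro: Min_le)
  have "c = (A *v y) $ m" using xc[OF m(1)] x by simp
  also have "\<dots> = (\<Sum>k\<in>UNIV. A $ m $ k * (y $ k - y $ m))" by (rule zero_row_sum_mult_vec[OF A])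
  also have "\<dots> \<le> 0"
  proof (rule sum_nonpos)
    fix k
    show "A $ m $ k * (y $ k - y $ m) \<le> 0"
    proof (cases "k = m \<or> A $ m $ k = 0")
      case False
      hence "k \<in> S" using m(1) by (auto simp: S_def depends_on_def intro: rtrancl_into_rtrancl)
      thus ?thesis using min Z_matrixD[OF A, of m k] False by (intro mult_nonpos_nonneg) auto
    qed auto
  qed
  finally show ?thesis .
qed

section \<open>Contraction in the maximum norm and exponential decay\<close>

lemma infnorm_cart_attained: "\<exists>i. infnorm (x :: real^'n) = \<bar>x $ i\<bar>"
proof -
  have "Max (range (\<lambda>i. \<bar>x $ i\<bar>)) \<in> range (\<lambda>i. \<bar>x $ i\<bar>)" by (intro Max_in) auto
  moreover have "infnorm x = Max (range (\<lambda>i. \<bar>x $ i\<bar>))"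
    unfolding infnorm_cart by (subst cSup_eq_Max) (auto simp: full_SetCompr_eq)
  ultimately show ?thesis by (metis imageE)
qed

lemma infnorm_matrix_exp_le:
  assumes A: "zero_row_sum_Z_matrix A" and "0 \<le> t"
  shows "infnorm (matrix_exp (t *\<^sub>R (- A)) *v x) \<le> infnorm x"
proof -
  let ?T = "matrix_exp (t *\<^sub>R (- A))"
  obtain i where i: "infnorm (?T *v x) = \<bar>(?T *v x) $ i\<bar>" using infnorm_cart_attained by blast
  have b: "\<bar>x $ j\<bar> \<le> infnorm x" for j by (rule component_le_infnorm_cart)
  have "(?T *v x) $ i \<le> infnorm x" "(?T *v (- x)) $ i \<le> infnorm x"
    using b by (intro matrix_exp_le assms; force simp: abs_le_iff)+
  thus ?thesis by (simp only: i abs_le_iff matvec.minus_right vector_uminus_component)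
qed

text \<open>If the norm stayed 1, a coordinate of the image of \<open>x\<close> or of
  \<open>- x\<close> would attain the upper bound 1, and \<open>matrix_exp_range_attained\<close>
  would give 1 \<le> 0. Membership in the range excludes the fixed constant vectors.\<close>

lemma infnorm_matrix_exp_less:
  assumes A: "zero_row_sum_Z_matrix A" and x: "x = A *v y" and 1: "infnorm x = 1"
  shows "infnorm (matrix_exp (1 *\<^sub>R (- A)) *v x) < 1"
proof (rule ccontr)
  let ?T = "matrix_exp (1 *\<^sub>R (- A))"
  assume "\<not> ?thesis"
  hence eq1: "infnorm (?T *v x) = 1" using infnorm_matrix_exp_le[OF A, of 1 x] 1 by simp
  obtain i where i: "infnorm (?T *v x) = \<bar>(?T *v x) $ i\<bar>" using infnorm_cart_attained by blast
  have b: "\<bar>x $ j\<bar> \<le> 1" for j using component_le_infnorm_cart[of x j] 1 by simp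
  from i eq1 consider "(?T *v x) $ i = 1" | "(?T *v (- x)) $ i = 1"
    by (force simp: abs_if matvec.minus_right split: if_splits)
  thus False
  proof cases
    case 1
    with matrix_exp_range_attained[OF A x, of 1 i] b show False by (force simp: abs_le_iff)
  next
    case 2
    have "- x = A *v (- y)" by (simp add: x matvec.minus_right)
    moreover have "(- x) $ j \<le> 1" for j using b[of j] by (simp add: abs_le_iff)
    ultimately show False using matrix_exp_range_attained[OF A _ _ 2] by fastforce
  qed
qed

text \<open>The unit sphere of the range is compact, so the strict inequality for single vectors
  becomes a uniform factor there; homogeneity extends it to the whole range.\<close>

lemma infnorm_matrix_exp_contraction:
  fixes A :: "real^'n^'n"
  assumes A: "zero_row_sum_Z_matrix A"
  obtains \<rho> where "0 < \<rho>" "\<rho> < 1"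
    "\<And>y. infnorm (matrix_exp (1 *\<^sub>R (- A)) *v (A *v y)) \<le> \<rho> * infnorm (A *v y)"
proof -
  let ?T = "matrix_exp (1 *\<^sub>R (- A))"
  define K where "K = range ((*v) A) \<inter> {x. infnorm x = 1}"
  have cont: "continuous_on S (infnorm :: real^'n \<Rightarrow> real)" for S
    by (intro continuous_intros)
  have "compact K"
  proof (rule compact_eq_bounded_closed[THEN iffD2], rule conjI)
    show "bounded K"
      unfolding bounded_iff
    proof (intro exI ballI)
      fix x assume "x \<in> K"
      thus "norm x \<le> sqrt DIM(real^'n)" using norm_le_infnorm[of x] by (simp add: K_def)
    qed
    have "subspace (range ((*v) A))" by (intro linear_subspace_image) auto
    moreover have "closed {x :: real^'n. infnorm x = 1}"
      using continuous_closed_preimage[OF cont[of UNIV], of "{1}"] by (simp add: vimage_def)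
    ultimately show "closed K" unfolding K_def using closed_subspace by blast
  qed
  have "\<exists>\<rho>. 0 < \<rho> \<and> \<rho> < 1 \<and> (\<forall>u\<in>K. infnorm (?T *v u) \<le> \<rho>)"
  proof (cases "K = {}")
    case True
    thus ?thesis by (intro exI[of _ "1/2"]) auto
  next
    case False
    have "continuous_on K (\<lambda>u. infnorm (?T *v u))"
      by (intro continuous_on_compose2[OF cont[of UNIV]] matvec.continuous_on continuous_intros) auto
    with continuous_attains_sup[OF \<open>compact K\<close> False] obtain u where
      u: "u \<in> K" "\<forall>v\<in>K. infnorm (?T *v v) \<le> infnorm (?T *v u)" by blast
    have "infnorm (?T *v u) < 1"
      using u(1) infnorm_matrix_exp_less[OF A] by (auto simp: K_def)
    \<comment> \<open>The floor \<open>1/2\<close> keeps \<open>\<rho>\<close> positive even if the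
      semigroup annihilates the range; the decay rate will be \<open>- ln \<rho>\<close>.\<close>
    thus ?thesis using u(2) by (intro exI[of _ "max (1/2) (infnorm (?T *v u))"]) (auto simp: le_max_iff_disj)
  qed
  then obtain \<rho> where \<rho>: "0 < \<rho>" "\<rho> < 1" "\<And>u. u \<in> K \<Longrightarrow> infnorm (?T *v u) \<le> \<rho>" by blast
  have "infnorm (?T *v (A *v y)) \<le> \<rho> * infnorm (A *v y)" for y
  proof (cases "infnorm (A *v y) = 0")
    case True
    thus ?thesis by (simp add: infnorm_eq_0 matvec.zero_right infnorm_0)
  next
    case False
    define n where "n = infnorm (A *v y)"
    have n: "n > 0" using False infnorm_pos_le[of "A *v y"] by (simp add: n_def)
    define u where "u = (1 / n) *\<^sub>R (A *v y)"
    have eq: "A *v y = n *\<^sub>R u" using n by (simp add: u_def)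
    have "u = A *v ((1 / n) *\<^sub>R y)" by (simp add: u_def matvec.scaleR_right)
    moreover have "infnorm u = 1" using n by (simp add: u_def infnorm_mul n_def[symmetric])
    ultimately have "u \<in> K" by (auto simp: K_def)
    from \<rho>(3)[OF this] n have "n * infnorm (?T *v u) \<le> n * \<rho>" by simp
    hence "infnorm (?T *v (n *\<^sub>R u)) \<le> \<rho> * n"
      using n by (simp add: matvec.scaleR_right infnorm_mul mult.commute)
    thus ?thesis by (simp only: eq[symmetric] n_def[symmetric])
  qed
  thus ?thesis using that \<rho> by blast
qed

text \<open>The semigroup commutes with \<open>A\<close> and so preserves its range; the contraction
  can therefore be iterated at integer times, and between them the maximum norm does not
  grow.\<close>

lemma matrix_exp_range_decay:
  fixes A :: "real^'n^'n"
  assumes A: "zero_row_sum_Z_matrix A"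
  obtains K c where "0 < c" "0 \<le> K"
    "\<And>t. 0 \<le> t \<Longrightarrow> norm (matrix_exp (t *\<^sub>R (- A)) ** A) \<le> K * exp (- c * t)"
proof -
  let ?T = "\<lambda>t. matrix_exp (t *\<^sub>R (- A))"
  obtain \<rho> where \<rho>: "0 < \<rho>" "\<rho> < 1" "\<And>y. infnorm (?T 1 *v (A *v y)) \<le> \<rho> * infnorm (A *v y)"
    using infnorm_matrix_exp_contraction[OF A] by metis
  have comm: "?T t *v (A *v y) = A *v (?T t *v y)" for t y
    using matrix_exp_commute[of "- A" t]
    by (simp add: matrix_vector_mul_assoc matmul.minus_left matmul.minus_right)
  have iter: "infnorm (?T (real n) *v (A *v y)) \<le> \<rho> ^ n * infnorm (A *v y)" for n y
  proof (induction n)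
    case (Suc n)
    have "?T (real (Suc n)) *v (A *v y) = ?T 1 *v (A *v (?T (real n) *v y))"
      by (simp add: matrix_exp_add matrix_vector_mul_assoc[symmetric] comm)
    also have "infnorm \<dots> \<le> \<rho> * infnorm (A *v (?T (real n) *v y))" by (rule \<rho>(3))
    also have "\<dots> \<le> \<rho> * (\<rho> ^ n * infnorm (A *v y))"
      using Suc \<rho>(1) by (simp add: comm)
    finally show ?case by simp
  qed simp
  define c where "c = - ln \<rho>"
  have c: "c > 0" using \<rho> by (simp add: c_def)
  have decay: "infnorm (?T t *v (A *v y)) \<le> exp c * infnorm (A *v y) * exp (- c * t)" if "0 \<le> t" for t y
  proof -
    \<comment> \<open>Rounding \<open>t\<close> down loses less than one time unit, which is paid
      for by the factor \<open>exp c\<close>.\<close>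
    define n where "n = nat \<lfloor>t\<rfloor>"
    have n: "real n \<le> t" "t - 1 \<le> real n" using that by (auto simp: n_def)
    have "?T t *v (A *v y) = ?T (t - real n) *v (?T (real n) *v (A *v y))"
      using matrix_exp_add[of "t - real n" "real n" "- A"] by (simp flip: matrix_vector_mul_assoc)
    also have "infnorm \<dots> \<le> infnorm (?T (real n) *v (A *v y))"
      using n by (intro infnorm_matrix_exp_le A) simp
    also have "\<dots> \<le> \<rho> ^ n * infnorm (A *v y)" by (rule iter)
    also have "\<rho> ^ n = exp (- c * real n)"
      using \<rho>(1) by (simp add: c_def mult.commute exp_of_nat_mult)
    also have "\<dots> \<le> exp (c + - c * t)"
      using mult_left_mono[OF n(2), of c] c by (simp add: algebra_simps)
    also have "\<dots> = exp c * exp (- c * t)" by (rule exp_add)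
    finally show ?thesis using infnorm_pos_le[of "A *v y"] by (simp add: mult_right_mono ac_simps)
  qed
  \<comment> \<open>The matrix norm is estimated by the sum of the absolute values of all entries,
    and the entries of column \<open>j\<close> by the decay of the image of
    \<open>A *v axis j 1\<close>; hence the double sum.\<close>
  define K where "K = (\<Sum>i\<in>(UNIV :: 'n set). \<Sum>j\<in>UNIV. exp c * infnorm (A *v axis j 1))"
  show ?thesis
  proof
    show "0 < c" by fact
    show "0 \<le> K" unfolding K_def by (intro sum_nonneg mult_nonneg_nonneg infnorm_pos_le) auto
    fix t :: real assume t: "0 \<le> t"
    have entry: "(?T t ** A) $ i $ j = (?T t *v (A *v axis j 1)) $ i" for i j
      by (simp add: matrix_vector_mul_assoc matrix_vector_mul_component inner_axis)
    have "norm (?T t ** A) \<le> (\<Sum>i\<in>UNIV. norm ((?T t ** A) $ i))"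
      unfolding norm_vec_def by (rule L2_set_le_sum) simp
    also have "\<dots> \<le> (\<Sum>i\<in>UNIV. \<Sum>j\<in>UNIV. \<bar>(?T t ** A) $ i $ j\<bar>)"
      by (intro sum_mono norm_le_l1_cart)
    also have "\<dots> \<le> (\<Sum>i\<in>(UNIV :: 'n set). \<Sum>j\<in>UNIV. exp c * infnorm (A *v axis j 1) * exp (- c * t))"
      unfolding entry by (intro sum_mono order.trans[OF component_le_infnorm_cart decay] t)
    also have "\<dots> = K * exp (- c * t)" by (simp add: K_def sum_distrib_right)
    finally show "norm (?T t ** A) \<le> K * exp (- c * t)" .
  qed
qed

text \<open>Integrating the bound from \<open>s\<close> onwards leaves at most
  \<open>K / c * exp (- c * s)\<close>, so the function is Cauchy and approaches its limit at the
  same rate.\<close>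

lemma exp_decay_derivative_imp_limit:
  fixes f :: "real \<Rightarrow> 'a::banach"
  assumes c: "0 < c" and K: "0 \<le> K"
    and deriv: "\<And>t. (f has_vector_derivative f' t) (at t)"
    and bound: "\<And>t. 0 \<le> t \<Longrightarrow> norm (f' t) \<le> K * exp (- c * t)"
  obtains l where "\<And>t. 0 \<le> t \<Longrightarrow> norm (f t - l) \<le> K / c * exp (- c * t)"
proof -
  have le: "norm (f t - f s) \<le> K / c * exp (- c * s)" if "0 \<le> s" "s \<le> t" for s t
  proof (cases "s = t")
    case True
    thus ?thesis using c K by simp
  next
    case False
    have "norm (f t - f s) \<le> - (K / c) * exp (- c * t) - - (K / c) * exp (- c * s)"
    proof (rule differentiable_bound_general)
      show "s < t" using that False by simp
      show "continuous_on {s..t} f"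
        by (intro continuous_at_imp_continuous_on ballI has_vector_derivative_continuous[OF deriv])
      show "continuous_on {s..t} (\<lambda>x. - (K / c) * exp (- c * x))" by (intro continuous_intros)
      show "((\<lambda>x. - (K / c) * exp (- c * x)) has_vector_derivative K * exp (- c * x)) (at x)" for x
        unfolding has_real_derivative_iff_has_vector_derivative[symmetric]
        using c by (auto intro!: derivative_eq_intros)
      show "norm (f' x) \<le> K * exp (- c * x)" if "s < x" "x < t" for x
        using bound[of x] that \<open>0 \<le> s\<close> by simp
    qed (rule deriv)
    also have "\<dots> \<le> K / c * exp (- c * s)" using c K by simp
    finally show ?thesis .
  qed
  have lim0: "(\<lambda>n. K / c * exp (- c * real n)) \<longlonglongrightarrow> 0"
    using c by real_asymp
  have "Cauchy (\<lambda>n. f (real n))"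
  proof (rule metric_CauchyI)
    fix e :: real assume "0 < e"
    with order_tendstoD(2)[OF lim0] obtain N where N: "\<And>n. n \<ge> N \<Longrightarrow> K / c * exp (- c * real n) < e / 2"
      unfolding eventually_sequentially by (meson half_gt_zero)
    have *: "norm (f (real n) - f (real N)) < e / 2" if "n \<ge> N" for n
    proof -
      have "norm (f (real n) - f (real N)) \<le> K / c * exp (- c * real N)" using that by (intro le) auto
      also have "\<dots> < e / 2" by (rule N) simp
      finally show ?thesis .
    qed
    show "\<exists>M. \<forall>m\<ge>M. \<forall>n\<ge>M. dist (f (real m)) (f (real n)) < e"
      using * by (metis dist_norm dist_commute dist_triangle_half_l)
  qed
  then obtain l where l: "(\<lambda>n. f (real n)) \<longlonglongrightarrow> l" by (auto simp: Cauchy_convergent_iff convergent_def)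
  show ?thesis
  proof
    fix t :: real assume t: "0 \<le> t"
    have "(\<lambda>n. norm (f t - f (real n))) \<longlonglongrightarrow> norm (f t - l)" by (intro tendsto_intros l)
    moreover have "eventually (\<lambda>n. norm (f t - f (real n)) \<le> K / c * exp (- c * t)) sequentially"
      using eventually_ge_at_top[of "nat \<lceil>t\<rceil>"]
    proof eventually_elim
      case (elim n)
      hence "t \<le> real n" by linarith
      with le[OF t this] show ?case by (simp add: norm_minus_commute)
    qed
    ultimately show "norm (f t - l) \<le> K / c * exp (- c * t)"
      using tendsto_upperbound by (metis trivial_limit_sequentially)
  qed
qed

section \<open>The limit of the semigroup as a projection onto the kernel\<close>

lemma norm_exp_decay_tendsto_0:
  fixes f :: "real \<Rightarrow> 'a::real_normed_vector"
  assumes "0 < c" and "\<And>t. 0 \<le> t \<Longrightarrow> norm (f t) \<le> K * exp (- c * t)"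
  shows "(f \<longlongrightarrow> 0) at_top"
proof (rule Lim_null_comparison)
  show "\<forall>\<^sub>F t in at_top. norm (f t) \<le> K * exp (- c * t)"
    using eventually_ge_at_top[of 0] by eventually_elim (rule assms)
  show "((\<lambda>t. K * exp (- c * t)) \<longlongrightarrow> 0) at_top" using assms(1) by real_asymp
qed

text \<open>The derivative of the semigroup is \<open>- A\<close> times the semigroup, which decays
  by \<open>matrix_exp_range_decay\<close>; the limit exists with a rate, and
  \<open>exp_limit\<close> picks it by uniqueness.\<close>

lemma exp_limit_decay:
  fixes A :: "real^'n^'n"
  assumes A: "zero_row_sum_Z_matrix A"
  obtains K c where "0 < c"
    "\<And>t. 0 \<le> t \<Longrightarrow> norm (matrix_exp (t *\<^sub>R (- A)) - exp_limit (- A)) \<le> K * exp (- c * t)"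
proof -
  let ?T = "\<lambda>t. matrix_exp (t *\<^sub>R (- A))"
  obtain K c where K: "0 < c" "0 \<le> K" "\<And>t. 0 \<le> t \<Longrightarrow> norm (?T t ** A) \<le> K * exp (- c * t)"
    using matrix_exp_range_decay[OF A] by metis
  have "norm (- A ** ?T t) \<le> K * exp (- c * t)" if "0 \<le> t" for t
    using K(3)[OF that] by (simp add: matrix_exp_commute matmul.minus_right)
  with exp_decay_derivative_imp_limit[OF K(1,2) matrix_exp_has_vector_derivative[of "- A" _ UNIV]]
  obtain J where J: "\<And>t. 0 \<le> t \<Longrightarrow> norm (?T t - J) \<le> K / c * exp (- c * t)" by blast
  have "((\<lambda>t. ?T t - J) \<longlongrightarrow> 0) at_top" by (rule norm_exp_decay_tendsto_0[OF K(1) J])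
  hence "(?T \<longlongrightarrow> J) at_top" by (simp add: LIM_zero_iff)
  hence "exp_limit (- A) = J" unfolding exp_limit_def by (intro tendsto_Lim) auto
  thus ?thesis using that K(1) J by blast
qed

lemma matrix_exp_tendsto_exp_limit:
  assumes "zero_row_sum_Z_matrix A"
  shows "((\<lambda>t. matrix_exp (t *\<^sub>R (- A))) \<longlongrightarrow> exp_limit (- A)) at_top"
proof -
  obtain K c where "0 < c"
    "\<And>t. 0 \<le> t \<Longrightarrow> norm (matrix_exp (t *\<^sub>R (- A)) - exp_limit (- A)) \<le> K * exp (- c * t)"
    using exp_limit_decay[OF assms] by metis
  from norm_exp_decay_tendsto_0[OF this] show ?thesis by (simp add: LIM_zero_iff)
qed

text \<open>The semigroup times \<open>A\<close> tends to 0, and by continuity to the product of the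
  limits. Together with \<open>exp_limit_right_kernel\<close> this makes
  \<open>exp_limit (- A)\<close> the projection onto the kernel of \<open>A\<close> along its
  range.\<close>

lemma exp_limit_mult_self:
  assumes A: "zero_row_sum_Z_matrix A"
  shows "A ** exp_limit (- A) = 0" "exp_limit (- A) ** A = 0"
proof -
  obtain K c where K: "0 < c" "0 \<le> K"
    "\<And>t. 0 \<le> t \<Longrightarrow> norm (matrix_exp (t *\<^sub>R (- A)) ** A) \<le> K * exp (- c * t)"
    using matrix_exp_range_decay[OF A] by metis
  have "((\<lambda>t. matrix_exp (t *\<^sub>R (- A)) ** A) \<longlongrightarrow> 0) at_top"
    by (rule norm_exp_decay_tendsto_0[OF K(1,3)])
  moreover have "((\<lambda>t. matrix_exp (t *\<^sub>R (- A)) ** A) \<longlongrightarrow> exp_limit (- A) ** A) at_top"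
    by (intro matmul.tendsto matrix_exp_tendsto_exp_limit A tendsto_const)
  moreover have "((\<lambda>t. A ** matrix_exp (t *\<^sub>R (- A))) \<longlongrightarrow> A ** exp_limit (- A)) at_top"
    by (intro matmul.tendsto matrix_exp_tendsto_exp_limit A tendsto_const)
  moreover have "A ** matrix_exp (t *\<^sub>R (- A)) = matrix_exp (t *\<^sub>R (- A)) ** A" for t
    using matrix_exp_commute[of "- A" t] by (simp add: matmul.minus_left matmul.minus_right)
  ultimately show "A ** exp_limit (- A) = 0" "exp_limit (- A) ** A = 0"
    by (auto intro: tendsto_unique[rotated])
qed

lemma matrix_exp_right_kernel:
  assumes "A ** B = 0"
  shows "matrix_exp (t *\<^sub>R (- A)) ** B = B"
proof (subst matrix_eq, intro allI)
  fix x
  have "- A *v (B *v x) = 0"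
    by (simp add: matrix_vector_mul_assoc matmul.minus_left assms matvec.zero_left)
  from matrix_exp_kernel[OF this]
  show "(matrix_exp (t *\<^sub>R (- A)) ** B) *v x = B *v x" by (simp add: matrix_vector_mul_assoc)
qed

lemma exp_limit_right_kernel:
  assumes A: "zero_row_sum_Z_matrix A" and "A ** B = 0"
  shows "exp_limit (- A) ** B = B"
proof -
  have "((\<lambda>t. matrix_exp (t *\<^sub>R (- A)) ** B) \<longlongrightarrow> exp_limit (- A) ** B) at_top"
    by (intro matmul.tendsto matrix_exp_tendsto_exp_limit A tendsto_const)
  thus ?thesis
    by (simp add: matrix_exp_right_kernel[OF assms(2)] tendsto_const_iff)
qed

lemma matrix_exp_left_kernel:
  assumes "B ** A = 0"
  shows "B ** matrix_exp (t *\<^sub>R (- A)) = B"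
proof -
  have "transpose A ** transpose B = 0"
    using assms linear_0[OF bounded_linear.linear[OF bounded_linear_transpose]]
    by (metis matrix_transpose_mul)
  from matrix_exp_right_kernel[OF this, of t]
  have "transpose (matrix_exp (t *\<^sub>R (- A))) ** transpose B = transpose B"
    using linear_neg[OF bounded_linear.linear[OF bounded_linear_transpose], of A]
    by (simp flip: matrix_exp_transpose)
  thus ?thesis by (metis matrix_transpose_mul transpose_transpose)
qed

lemma exp_limit_left_kernel:
  assumes A: "zero_row_sum_Z_matrix A" and "B ** A = 0"
  shows "B ** exp_limit (- A) = B"
proof -
  have "((\<lambda>t. B ** matrix_exp (t *\<^sub>R (- A))) \<longlongrightarrow> B ** exp_limit (- A)) at_top"
    by (intro matmul.tendsto matrix_exp_tendsto_exp_limit A tendsto_const)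
  thus ?thesis
    by (simp add: matrix_exp_left_kernel[OF assms(2)] tendsto_const_iff)
qed

section \<open>Reduction by clustering\<close>

lemma matrix_inv_eqI:
  fixes A :: "'a::field^'n^'n"
  assumes "A ** B = mat 1"
  shows "matrix_inv A = B"
proof -
  have *: "B ** A = mat 1" using assms by (simp add: matrix_left_right_inverse)
  have "A ** matrix_inv A = mat 1 \<and> matrix_inv A ** A = mat 1"
    unfolding matrix_inv_def by (rule someI[of _ B]) (use assms * in simp)
  hence "B ** (A ** matrix_inv A) = B" by simp
  thus ?thesis unfolding matrix_mul_assoc * by simp
qed

lemma diag_mat_mult_entry:
  fixes B :: "'a::semiring_1^'m^'n"
  shows "(diag_mat a ** B) $ i $ j = a $ i * B $ i $ j"
  by (simp add: diag_mat_def matrix_matrix_mult_def if_distrib[of "\<lambda>x. x * _"] sum.delta cong: if_cong)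

lemma mult_diag_mat_entry:
  fixes B :: "'a::semiring_1^'m^'n"
  shows "(B ** diag_mat a) $ i $ j = B $ i $ j * a $ j"
  by (simp add: diag_mat_def matrix_matrix_mult_def if_distrib[of "\<lambda>x. _ * x"] sum.delta cong: if_cong)

lemma diag_mat_mult: "diag_mat a ** diag_mat b = diag_mat (\<chi> i. a $ i * b $ i)"
  for a :: "'a::semiring_1^'n"
  by (simp add: vec_eq_iff diag_mat_mult_entry) (simp add: diag_mat_def)

lemma transpose_diag_mat [simp]: "transpose (diag_mat a) = diag_mat a"
  by (auto simp: diag_mat_def transpose_def vec_eq_iff)

lemma zero_row_sum_Z_matrix_laplacian:
  assumes "\<And>i j. 0 \<le> W $ i $ j"
  shows "zero_row_sum_Z_matrix (laplacian W)"
  unfolding zero_row_sum_Z_matrix_def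
proof (intro conjI allI impI)
  have "(\<Sum>j\<in>UNIV. laplacian W $ i $ j) = 0" for i
    by (simp add: laplacian_def diag_mat_def matrix_vector_mult_def sum_subtractf)
  thus "laplacian W *v 1 = 0" by (simp add: vec_eq_iff matrix_vector_mult_def)
  show "laplacian W $ i $ j \<le> 0" if "i \<noteq> j" for i j
    using that assms by (simp add: laplacian_def diag_mat_def)
qed

locale weighted_clustering =
  fixes C :: "'r::finite \<Rightarrow> 'n::finite set" and m :: "real^'n"
  assumes graph_clustering: "graph_clustering C" and m_pos: "\<And>i. 0 < m $ i"
begin

abbreviation Q :: "real^'r^'n" where "Q \<equiv> char_matrix C"
abbreviation Qd :: "real^'n^'r" where "Qd \<equiv> weighted_pinv (diag_mat m) Q"

definition mass :: "'r \<Rightarrow> real" where "mass k = (\<Sum>i\<in>C k. m $ i)"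

lemma cell_nonempty: "C k \<noteq> {}"
  using graph_clustering by (simp add: graph_clustering_def)

lemma cell_unique: "i \<in> C k \<Longrightarrow> i \<in> C l \<Longrightarrow> k = l"
  using graph_clustering by (auto simp: graph_clustering_def disjoint_family_on_def)

lemma cell_exists: "\<exists>k. i \<in> C k"
  using graph_clustering by (auto simp: graph_clustering_def)

lemma mass_pos: "0 < mass k"
  unfolding mass_def using cell_nonempty m_pos by (intro sum_pos) auto

lemma char_matrix_entry: "Q $ i $ k = (if i \<in> C k then 1 else 0)"
  by (simp add: char_matrix_def)

lemma char_matrix_mult_vec:
  assumes "i \<in> C k"
  shows "(Q *v y) $ i = y $ k"
proof -
  have "Q $ i $ l * y $ l = (if l = k then y $ l else 0)" for l
    using assms cell_unique by (auto simp: char_matrix_entry)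
  thus ?thesis by (simp add: matrix_vector_mult_def)
qed

lemma char_matrix_ones: "Q *v 1 = 1"
proof -
  have "(Q *v 1) $ i = 1" for i using cell_exists[of i] char_matrix_mult_vec by force
  thus ?thesis by (simp add: vec_eq_iff)
qed

lemma const_on_cells:
  assumes "\<And>k i j. i \<in> C k \<Longrightarrow> j \<in> C k \<Longrightarrow> v $ i = v $ j"
  obtains a where "v = Q *v a"
proof
  have "v $ i = (Q *v (\<chi> k. v $ (SOME j. j \<in> C k))) $ i" for i
  proof -
    obtain k where k: "i \<in> C k" using cell_exists by blast
    hence "(SOME j. j \<in> C k) \<in> C k" by (rule someI)
    with assms[OF k] show ?thesis by (simp add: char_matrix_mult_vec[OF k])
  qed
  thus "v = Q *v (\<chi> k. v $ (SOME j. j \<in> C k))" unfolding vec_eq_iff by blast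
qed

lemma gram: "transpose Q ** diag_mat m ** Q = diag_mat (\<chi> k. mass k)"
proof -
  have "(transpose Q ** diag_mat m ** Q) $ k $ l = diag_mat (\<chi> k. mass k) $ k $ l" for k l
  proof -
    have "(transpose Q ** diag_mat m) $ k $ j = (if j \<in> C k then m $ j else 0)" for j
      by (simp add: mult_diag_mat_entry transpose_def char_matrix_entry)
    hence "(transpose Q ** diag_mat m ** Q) $ k $ l = (\<Sum>j\<in>UNIV. if j \<in> C k \<and> j \<in> C l then m $ j else 0)"
      by (subst matrix_matrix_mult_def) (auto simp: char_matrix_entry intro!: sum.cong)
    also have "\<dots> = (\<Sum>j\<in>C k \<inter> C l. m $ j)"
      by (rule sum.mono_neutral_cong_right) auto
    also have "\<dots> = diag_mat (\<chi> k. mass k) $ k $ l"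
    proof (cases "k = l")
      case False
      hence "C k \<inter> C l = {}" using cell_unique by blast
      thus ?thesis using False by (simp add: diag_mat_def)
    qed (simp add: diag_mat_def mass_def)
    finally show ?thesis .
  qed
  thus ?thesis by (simp add: vec_eq_iff)
qed

lemma gram_inv:
  "matrix_inv (transpose Q ** diag_mat m ** Q) = diag_mat (\<chi> k. 1 / mass k)"
proof (rule matrix_inv_eqI)
  have "mass k \<noteq> 0" for k using mass_pos[of k] by simp
  thus "transpose Q ** diag_mat m ** Q ** diag_mat (\<chi> k. 1 / mass k) = mat 1"
    by (simp add: gram diag_mat_mult) (simp add: diag_mat_def mat_def vec_eq_iff)
qed

lemma weighted_pinv_eq: "Qd = diag_mat (\<chi> k. 1 / mass k) ** transpose Q ** diag_mat m"
  by (simp add: weighted_pinv_def gram_inv)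

text \<open>Row \<open>k\<close> of \<open>Qd\<close> is the \<open>m\<close>-weighted average over
  cell \<open>k\<close>; its nonnegativity preserves the sign pattern under reduction.\<close>

lemma weighted_pinv_entry: "Qd $ k $ i = (if i \<in> C k then m $ i / mass k else 0)"
  unfolding weighted_pinv_eq
  by (simp add: mult_diag_mat_entry diag_mat_mult_entry transpose_def char_matrix_entry)

lemma weighted_pinv_left_inverse: "Qd ** Q = mat 1"
proof -
  have "mass k \<noteq> 0" for k using mass_pos[of k] by simp
  hence "diag_mat (\<chi> k. 1 / mass k) ** (transpose Q ** diag_mat m ** Q) = mat 1"
    by (simp add: gram diag_mat_mult) (simp add: diag_mat_def mat_def vec_eq_iff)
  thus ?thesis by (simp add: weighted_pinv_eq matrix_mul_assoc)
qed

text \<open>Flattened to one sum over pairs, so that sign arguments apply term by term.\<close>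

lemma reduced_entry:
  "(Qd ** A ** Q) $ k $ l = (\<Sum>(j, i)\<in>UNIV. Qd $ k $ i * A $ i $ j * Q $ j $ l)"
  unfolding UNIV_Times_UNIV[symmetric] sum.cartesian_product[symmetric]
  by (simp add: matrix_matrix_mult_def sum_distrib_right)

text \<open>Vertices of distinct cells are distinct, so only off-diagonal entries of
  \<open>A\<close> contribute.\<close>

lemma reduced_term_nonpos:
  assumes A: "zero_row_sum_Z_matrix A" and "k \<noteq> l"
  shows "Qd $ k $ i * A $ i $ j * Q $ j $ l \<le> 0"
proof (cases "i \<in> C k \<and> j \<in> C l")
  case True
  hence "i \<noteq> j" using assms(2) cell_unique by blast
  with True Z_matrixD[OF A, of i j] m_pos[of i] mass_pos[of k] show ?thesis
    by (simp add: weighted_pinv_entry char_matrix_entry divide_le_0_iff mult_le_0_iff)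
qed (auto simp: weighted_pinv_entry char_matrix_entry)

lemma zero_row_sum_Z_matrix_reduced:
  assumes A: "zero_row_sum_Z_matrix A"
  shows "zero_row_sum_Z_matrix (Qd ** A ** Q)"
  unfolding zero_row_sum_Z_matrix_def
proof (intro conjI allI impI)
  show "(Qd ** A ** Q) *v 1 = 0"
    using A by (simp add: char_matrix_ones zero_row_sum_Z_matrix_def matvec.zero_right flip:
        matrix_vector_mul_assoc)
  show "(Qd ** A ** Q) $ k $ l \<le> 0" if "k \<noteq> l" for k l
    unfolding reduced_entry using reduced_term_nonpos[OF A that] by (intro sum_nonpos) auto
qed

text \<open>Terms between distinct cells have one sign and cannot cancel, so every dependence
  between vertices of distinct cells survives in the quotient.\<close>

lemma reduced_entry_neg:
  assumes A: "zero_row_sum_Z_matrix A" and kl: "k \<noteq> l" "i \<in> C k" "j \<in> C l" and ij: "A $ i $ j \<noteq> 0"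
  shows "(Qd ** A ** Q) $ k $ l \<noteq> 0"
proof
  assume "(Qd ** A ** Q) $ k $ l = 0"
  hence "(\<Sum>(j, i)\<in>UNIV. - (Qd $ k $ i * A $ i $ j * Q $ j $ l)) = 0"
    by (simp add: reduced_entry sum_negf case_prod_unfold)
  hence "Qd $ k $ i * A $ i $ j * Q $ j $ l = 0"
    using reduced_term_nonpos[OF A kl(1)] by (subst (asm) sum_nonneg_eq_0_iff) auto
  thus False using kl ij m_pos[of i] mass_pos[of k] by (simp add: weighted_pinv_entry char_matrix_entry)
qed

end

text \<open>If \<open>T\<close> is closed under dependence, the vectors vanishing on
  \<open>T\<close> form an \<open>A\<close>-invariant subspace, preserved by each term of the
  series.\<close>

lemma matrix_exp_invariant_zeros:
  assumes closed: "\<And>i j. i \<in> T \<Longrightarrow> A $ i $ j \<noteq> 0 \<Longrightarrow> j \<in> T"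
    and v: "\<And>i. i \<in> T \<Longrightarrow> v $ i = 0" and i: "i \<in> T"
  shows "(matrix_exp A *v v) $ i = 0"
proof -
  have "(mpow A k *v v) $ i = 0" if "i \<in> T" for i k
    using that
  proof (induction k arbitrary: i)
    case (Suc k)
    have "(mpow A (Suc k) *v v) $ i = (\<Sum>j\<in>UNIV. A $ i $ j * (mpow A k *v v) $ j)"
      by (simp add: matrix_vector_mul_assoc[symmetric]) (simp add: matrix_vector_mult_def)
    also have "\<dots> = 0" using Suc closed by (intro sum.neutral) force
    finally show ?case .
  qed (use v in simp)
  moreover have "(\<lambda>k. (((1 / fact k) *\<^sub>R mpow A k) *v v) $ i) sums ((matrix_exp A *v v) $ i)"
    by (intro bounded_linear.sums[OF bounded_linear_vec_nth] bounded_linear.sums[OF matvec.bounded_linear_left]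
        matrix_exp_sums)
  ultimately show ?thesis using i by (simp add: matvec.scaleR_left sums_iff)
qed

lemma exp_limit_invariant_zeros:
  assumes A: "zero_row_sum_Z_matrix A"
    and closed: "\<And>i j. i \<in> T \<Longrightarrow> A $ i $ j \<noteq> 0 \<Longrightarrow> j \<in> T"
    and v: "\<And>i. i \<in> T \<Longrightarrow> v $ i = 0" and i: "i \<in> T"
  shows "(exp_limit (- A) *v v) $ i = 0"
proof -
  have "((\<lambda>t. (matrix_exp (t *\<^sub>R (- A)) *v v) $ i) \<longlongrightarrow> (exp_limit (- A) *v v) $ i) at_top"
    by (intro tendsto_vec_nth matvec.tendsto matrix_exp_tendsto_exp_limit A tendsto_const)
  moreover have "(matrix_exp (t *\<^sub>R (- A)) *v v) $ i = 0" for t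
    by (rule matrix_exp_invariant_zeros[of T]) (use closed v i in auto)
  ultimately show ?thesis by (simp add: tendsto_const_iff)
qed

section \<open>Identification of the limit of the reduced semigroup\<close>

context weighted_clustering
begin

text \<open>At a maximum \<open>c\<close> of \<open>y\<close> the kernel equation forces the value
  \<open>c\<close> on all dependent cells, so the vertices where \<open>Q *v y\<close> equals
  \<open>c\<close> are closed under dependence of \<open>A\<close>. There
  \<open>Q *v y - c *\<^sub>R 1\<close> vanishes, hence so does its image under the limit; but that
  image is \<open>- c\<close> everywhere. Thus \<open>c = 0\<close>.\<close>

lemma reduced_kernel_nonpos:
  assumes A: "zero_row_sum_Z_matrix A"
    and ker: "(Qd ** A ** Q) *v y = 0" and lim: "exp_limit (- A) *v (Q *v y) = 0"
  shows "y $ k \<le> 0"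
proof -
  let ?Ar = "Qd ** A ** Q"
  have Ar: "zero_row_sum_Z_matrix ?Ar" by (rule zero_row_sum_Z_matrix_reduced[OF A])
  define c where "c = Max (range (($) y))"
  have "c \<in> range (($) y)" unfolding c_def by (rule Max_in) auto
  then obtain k0 where k0: "y $ k0 = c" by auto
  have le: "y $ l \<le> c" for l by (simp add: c_def)
  have spread: "y $ l = c" if "y $ k = c" "?Ar $ k $ l \<noteq> 0" for k l
  proof -
    have "(\<Sum>l\<in>UNIV. ?Ar $ k $ l * (y $ l - y $ k)) = 0"
      using zero_row_sum_mult_vec[OF Ar, of y k] ker by simp
    moreover have "0 \<le> ?Ar $ k $ l * (y $ l - y $ k)" for l
      using le[of l] that(1) Z_matrixD[OF Ar, of k l] by (cases "l = k") (auto intro: mult_nonpos_nonpos)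
    ultimately have "?Ar $ k $ l * (y $ l - y $ k) = 0"
      by (subst (asm) sum_nonneg_eq_0_iff) auto
    thus ?thesis using that by simp
  qed
  define T where "T = {i. (Q *v y) $ i = c}"
  obtain i where i: "i \<in> C k0" using cell_nonempty by blast
  hence "i \<in> T" by (simp add: T_def char_matrix_mult_vec k0)
  have closed: "j \<in> T" if "i \<in> T" "A $ i $ j \<noteq> 0" for i j
  proof -
    obtain k l where kl: "i \<in> C k" "j \<in> C l" using cell_exists by blast
    have "y $ k = c" using that kl by (simp add: T_def char_matrix_mult_vec)
    hence "y $ l = c" using spread reduced_entry_neg[OF A _ kl that(2)] by (cases "k = l") auto
    thus ?thesis using kl by (simp add: T_def char_matrix_mult_vec)
  qed
  have "(exp_limit (- A) *v (Q *v y - c *\<^sub>R 1)) $ i = 0"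
    by (rule exp_limit_invariant_zeros[OF A closed _ \<open>i \<in> T\<close>]) (auto simp: T_def)
  moreover have "exp_limit (- A) *v 1 = 1"
  proof -
    have "((\<lambda>t. matrix_exp (t *\<^sub>R (- A)) *v 1) \<longlongrightarrow> exp_limit (- A) *v 1) at_top"
      by (intro matvec.tendsto matrix_exp_tendsto_exp_limit A tendsto_const)
    moreover have "- A *v 1 = 0" using A by (simp add: zero_row_sum_Z_matrix_def matvec.minus_left)
    ultimately show ?thesis by (simp add: matrix_exp_kernel tendsto_const_iff)
  qed
  ultimately have "c = 0"
    by (simp add: matvec.diff_right matvec.scaleR_right lim)
  thus ?thesis using le by simp
qed

lemma reduced_kernel_trivial:
  assumes A: "zero_row_sum_Z_matrix A"
    and ker: "(Qd ** A ** Q) *v y = 0" and lim: "exp_limit (- A) *v (Q *v y) = 0"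
  shows "y = 0"
proof -
  have "y $ k \<le> 0" for k using reduced_kernel_nonpos[OF assms] .
  moreover have "(- y) $ k \<le> 0" for k
    using ker lim by (intro reduced_kernel_nonpos[OF A]) (simp_all add: matvec.minus_right)
  ultimately show ?thesis by (auto simp: vec_eq_iff intro: antisym)
qed

text \<open>The candidate \<open>Z = Qd ** J ** Q\<close> is idempotent and is annihilated by the
  reduced matrix from both sides. The difference \<open>y\<close> of the two limits at a vector lies
  in the reduced kernel and satisfies \<open>Z *v y = 0\<close>, hence
  \<open>J *v (Q *v y) = 0\<close>, and \<open>reduced_kernel_trivial\<close> applies.\<close>

lemma exp_limit_reduced:
  assumes A: "zero_row_sum_Z_matrix A"
    and QJ: "Q ** Qd ** exp_limit (- A) = exp_limit (- A)"
    and JQ: "exp_limit (- A) ** Q ** Qd = exp_limit (- A)"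
  shows "exp_limit (- (Qd ** A ** Q)) = Qd ** exp_limit (- A) ** Q"
proof (subst matrix_eq, intro allI)
  fix x
  define J where "J = exp_limit (- A)"
  define Ar where "Ar = Qd ** A ** Q"
  define Jr where "Jr = exp_limit (- Ar)"
  define Z where "Z = Qd ** J ** Q"
  have Ar: "zero_row_sum_Z_matrix Ar" unfolding Ar_def by (rule zero_row_sum_Z_matrix_reduced[OF A])
  note J = exp_limit_mult_self[OF A, folded J_def]
  have JJ: "J ** J = J" unfolding J_def by (rule exp_limit_right_kernel[OF A exp_limit_mult_self(1)[OF A]])
  have ZAr: "Z ** Ar = 0"
  proof -
    have "Z ** Ar = Qd ** (J ** Q ** Qd) ** A ** Q" by (simp add: Z_def Ar_def matrix_mul_assoc)
    also have "\<dots> = Qd ** (J ** A) ** Q" unfolding JQ[folded J_def] by (simp add: matrix_mul_assoc)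
    finally show ?thesis by (simp add: J matmul.zero_left matmul.zero_right)
  qed
  have ArZ: "Ar ** Z = 0"
  proof -
    have "Ar ** Z = Qd ** A ** (Q ** Qd ** J) ** Q" by (simp add: Z_def Ar_def matrix_mul_assoc)
    also have "\<dots> = Qd ** (A ** J) ** Q" unfolding QJ[folded J_def] by (simp add: matrix_mul_assoc)
    finally show ?thesis by (simp add: J matmul.zero_left matmul.zero_right)
  qed
  have ZZ: "Z ** Z = Z"
  proof -
    have "Z ** Z = Qd ** (J ** Q ** Qd) ** J ** Q" by (simp add: Z_def matrix_mul_assoc)
    also have "\<dots> = Qd ** (J ** J) ** Q" unfolding JQ[folded J_def] by (simp add: matrix_mul_assoc)
    finally show ?thesis by (simp add: JJ Z_def)
  qed
  have ZJr: "Z ** Jr = Z" unfolding Jr_def by (rule exp_limit_left_kernel[OF Ar ZAr])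
  define y where "y = Jr *v x - Z *v x"
  have "Ar *v y = (Ar ** Jr) *v x - (Ar ** Z) *v x"
    by (simp add: y_def matvec.diff_right matrix_vector_mul_assoc)
  also have "\<dots> = 0" unfolding ArZ Jr_def exp_limit_mult_self(1)[OF Ar] by simp
  finally have 1: "(Qd ** A ** Q) *v y = 0" by (simp add: Ar_def)
  have "Z *v y = (Z ** Jr) *v x - (Z ** Z) *v x"
    by (simp add: y_def matvec.diff_right matrix_vector_mul_assoc)
  hence "Z *v y = 0" by (simp add: ZJr ZZ)
  have "J *v (Q *v y) = (Q ** Qd ** J) *v (Q *v y)" by (simp add: QJ[folded J_def])
  also have "\<dots> = Q *v (Z *v y)" by (simp add: Z_def matrix_vector_mul_assoc matrix_mul_assoc)
  finally have "J *v (Q *v y) = 0" by (simp add: \<open>Z *v y = 0\<close> matvec.zero_right)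
  from reduced_kernel_trivial[OF A 1 this[unfolded J_def]] have "Jr *v x = Z *v x" by (simp add: y_def)
  thus "exp_limit (- (Qd ** A ** Q)) *v x = (Qd ** exp_limit (- A) ** Q) *v x"
    by (simp add: Jr_def Ar_def Z_def J_def)
qed

text \<open>Columns of \<open>J\<close> lie in the kernel of \<open>A\<close>, rows in that of
  \<open>transpose A\<close>. The two halves of clusterability make the former, and suitably
  rescaled the latter, constant on cells.\<close>

lemma clusterable_imp_exp_limit:
  assumes A: "zero_row_sum_Z_matrix A" and proper: "proper_clustering (diag_mat m ** A) C"
  shows "Q ** Qd ** exp_limit (- A) = exp_limit (- A)"
    and "exp_limit (- A) ** Q ** Qd = exp_limit (- A)"
proof -
  define J where "J = exp_limit (- A)"
  note J = exp_limit_mult_self[OF A, folded J_def]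
  \<comment> \<open>Orthogonality of \<open>axis i 1 - axis j 1\<close> to the kernel says that
    every kernel vector has equal coordinates at \<open>i\<close> and \<open>j\<close>.\<close>
  have perp: "v $ i = v $ j" if "axis i 1 - axis j 1 \<in> (mat_ker B)\<^sup>\<bottom>" "B *v v = 0" for i j v and B ::
      "real^'n^'n"
    using that by (auto simp: orthogonal_comp_def mat_ker_def orthogonal_def inner_diff_right
        inner_diff_left inner_axis inner_axis')
  have "(Q ** Qd ** J) *v x = J *v x" for x
  proof -
    have "(diag_mat m ** A) *v (J *v x) = 0"
      by (simp add: matrix_vector_mul_assoc matrix_mul_assoc[symmetric] J matmul.zero_right)
    hence "(J *v x) $ i = (J *v x) $ j" if "i \<in> C k" "j \<in> C k" for i j k
      using proper that perp by (metis clusterable_def proper_clustering_def)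
    then obtain a where a: "J *v x = Q *v a" using const_on_cells by metis
    have "(Q ** Qd ** J) *v x = (Q ** (Qd ** Q)) *v a" by (simp add: a matrix_mul_assoc flip:
        matrix_vector_mul_assoc)
    thus ?thesis by (simp add: weighted_pinv_left_inverse a)
  qed
  thus "Q ** Qd ** exp_limit (- A) = exp_limit (- A)" by (simp add: matrix_eq J_def)
  have "transpose (J ** Q ** Qd) *v x = transpose J *v x" for x
  proof -
    \<comment> \<open>The transpose of \<open>diag_mat m ** A\<close> is
      \<open>transpose A ** diag_mat m\<close>, so its kernel consists of the kernel vectors of
      \<open>transpose A\<close> divided by \<open>m\<close>.\<close>
    define w where "w = diag_mat (\<chi> i. 1 / m $ i) *v (transpose J *v x)"
    have "m $ i \<noteq> 0" for i using m_pos[of i] by simp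
    hence "diag_mat m ** diag_mat (\<chi> i. 1 / m $ i) = mat 1"
      by (simp add: diag_mat_mult) (simp add: diag_mat_def mat_def vec_eq_iff)
    hence Jx: "transpose J *v x = diag_mat m *v w" by (simp add: w_def matrix_vector_mul_assoc)
    have "transpose (diag_mat m ** A) *v w = (transpose A ** transpose J) *v x"
      by (simp only: matrix_transpose_mul transpose_diag_mat matrix_vector_mul_assoc[symmetric] Jx)
    also have "\<dots> = 0"
      using J linear_0[OF bounded_linear.linear[OF bounded_linear_transpose]]
      by (metis matrix_transpose_mul matvec.zero_left)
    finally have "w $ i = w $ j" if "i \<in> C k" "j \<in> C k" for i j k
      using proper that perp by (metis clusterable_def proper_clustering_def)
    then obtain b where b: "w = Q *v b" using const_on_cells by metis
    have "mass k \<noteq> 0" for k using mass_pos[of k] by simp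
    hence inv: "diag_mat (\<chi> k. 1 / mass k) ** (transpose Q ** diag_mat m ** Q) = mat 1"
      by (simp add: gram diag_mat_mult) (simp add: diag_mat_def mat_def vec_eq_iff)
    \<comment> \<open>The transpose of \<open>Q ** Qd\<close> acts as the identity on vectors
      \<open>diag_mat m *v (Q *v b)\<close>, because the Gram matrix meets its inverse.\<close>
    have "transpose (J ** Q ** Qd) *v x = transpose Qd *v (transpose Q *v (diag_mat m *v (Q *v b)))"
      by (simp only: matrix_transpose_mul matrix_vector_mul_assoc[symmetric] Jx b)
    also have "\<dots> = diag_mat m *v (Q *v ((diag_mat (\<chi> k. 1 / mass k) ** (transpose Q ** diag_mat m ** Q)) *v b))"
      by (simp only: weighted_pinv_eq matrix_transpose_mul transpose_diag_mat transpose_transpose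
          matrix_vector_mul_assoc[symmetric])
    finally show ?thesis by (simp only: inv Jx b matrix_vector_mul_lid)
  qed
  hence "transpose (J ** Q ** Qd) = transpose J" by (subst matrix_eq) blast
  thus "exp_limit (- A) ** Q ** Qd = exp_limit (- A)" by (simp add: J_def)
qed

end

section \<open>Exponentially decaying functions and the Laplace transform\<close>

text \<open>Continuity on the whole line provides measurability, while decay concerns nonnegative
  times only. Closure under bounded linear and bilinear maps then settles the integrability of all
  Gramian integrands.\<close>

definition exp_decaying :: "(real \<Rightarrow> 'a::real_normed_vector) \<Rightarrow> bool" where
  "exp_decaying f \<longleftrightarrow> continuous_on UNIV f \<and> (\<exists>K c. 0 < c \<and> (\<forall>t\<ge>0. norm (f t) \<le> K * exp (- c * t)))"

lemma exp_decayingI: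
  assumes "continuous_on UNIV f" "0 < c" "\<And>t. 0 \<le> t \<Longrightarrow> norm (f t) \<le> K * exp (- c * t)"
  shows "exp_decaying f"
  using assms unfolding exp_decaying_def by blast

lemma exp_decayingE:
  assumes "exp_decaying f"
  obtains K c where "0 < c" "0 \<le> K" "\<And>t. 0 \<le> t \<Longrightarrow> norm (f t) \<le> K * exp (- c * t)"
proof -
  from assms obtain K c where *: "0 < c" "\<forall>t\<ge>0. norm (f t) \<le> K * exp (- c * t)"
    by (auto simp: exp_decaying_def)
  moreover have "0 \<le> K" using spec[OF *(2), of 0] order.trans[OF norm_ge_zero[of "f 0"]] by simp
  ultimately show ?thesis using that by blast
qed

lemma exp_decaying_bounded_linear:
  assumes F: "bounded_linear F" and f: "exp_decaying f"
  shows "exp_decaying (\<lambda>t. F (f t))"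
proof -
  obtain K c where K: "0 < c" "0 \<le> K" "\<And>t. 0 \<le> t \<Longrightarrow> norm (f t) \<le> K * exp (- c * t)"
    using exp_decayingE[OF f] by metis
  obtain B where B: "0 \<le> B" "\<And>x. norm (F x) \<le> norm x * B"
    using bounded_linear.nonneg_bounded[OF F] by blast
  have "norm (F (f t)) \<le> (K * B) * exp (- c * t)" if "0 \<le> t" for t
    using order.trans[OF B(2) mult_right_mono[OF K(3)[OF that] B(1)]] by (simp add: ac_simps)
  moreover have "continuous_on UNIV (\<lambda>t. F (f t))"
    using f by (intro bounded_linear.continuous_on[OF F]) (simp add: exp_decaying_def)
  ultimately show ?thesis using K(1) by (intro exp_decayingI)
qed

lemma exp_decaying_bounded_bilinear:
  assumes F: "bounded_bilinear F" and f: "exp_decaying f" and g: "exp_decaying g"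
  shows "exp_decaying (\<lambda>t. F (f t) (g t))"
proof -
  obtain K c where K: "0 < c" "0 \<le> K" "\<And>t. 0 \<le> t \<Longrightarrow> norm (f t) \<le> K * exp (- c * t)"
    using exp_decayingE[OF f] by metis
  obtain L d where L: "0 < d" "0 \<le> L" "\<And>t. 0 \<le> t \<Longrightarrow> norm (g t) \<le> L * exp (- d * t)"
    using exp_decayingE[OF g] by metis
  obtain B where B: "0 \<le> B" "\<And>x y. norm (F x y) \<le> norm x * norm y * B"
    using bounded_bilinear.nonneg_bounded[OF F] by blast
  have "norm (F (f t) (g t)) \<le> (K * L * B) * exp (- (c + d) * t)" if "0 \<le> t" for t
  proof -
    have "norm (F (f t) (g t)) \<le> norm (f t) * norm (g t) * B" by (rule B)
    also have "\<dots> \<le> (K * exp (- c * t)) * (L * exp (- d * t)) * B"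
      using K L B that by (intro mult_right_mono mult_mono) auto
    also have "\<dots> = (K * L * B) * (exp (- c * t) * exp (- d * t))" by simp
    also have "exp (- c * t) * exp (- d * t) = exp (- (c + d) * t)"
      by (simp add: exp_add[symmetric] algebra_simps)
    finally show ?thesis .
  qed
  moreover have "continuous_on UNIV (\<lambda>t. F (f t) (g t))"
    using f g by (intro bounded_bilinear.continuous_on[OF F]) (simp_all add: exp_decaying_def)
  moreover have "0 < c + d" using K L by simp
  ultimately show ?thesis by (intro exp_decayingI)
qed

lemma exp_decaying_diff:
  assumes f: "exp_decaying f" and g: "exp_decaying g"
  shows "exp_decaying (\<lambda>t. f t - g t)"
proof -
  obtain K c where K: "0 < c" "0 \<le> K" "\<And>t. 0 \<le> t \<Longrightarrow> norm (f t) \<le> K * exp (- c * t)"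
    using exp_decayingE[OF f] by metis
  obtain L d where L: "0 < d" "0 \<le> L" "\<And>t. 0 \<le> t \<Longrightarrow> norm (g t) \<le> L * exp (- d * t)"
    using exp_decayingE[OF g] by metis
  have "norm (f t - g t) \<le> (K + L) * exp (- min c d * t)" if "0 \<le> t" for t
  proof -
    have "norm (f t - g t) \<le> norm (f t) + norm (g t)" by (rule norm_triangle_ineq4)
    also have "\<dots> \<le> K * exp (- c * t) + L * exp (- d * t)" using K(3) L(3) that by (intro add_mono)
    also have "\<dots> \<le> K * exp (- min c d * t) + L * exp (- min c d * t)"
      using K L that by (intro add_mono mult_left_mono) (auto intro: mult_right_mono)
    finally show ?thesis by (simp add: algebra_simps)
  qed
  moreover have "continuous_on UNIV (\<lambda>t. f t - g t)"
    using f g by (auto simp: exp_decaying_def intro!: continuous_intros)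
  moreover have "0 < min c d" using K L by simp
  ultimately show ?thesis by (intro exp_decayingI)
qed

lemma exp_decaying_sum:
  assumes "\<And>i. i \<in> I \<Longrightarrow> exp_decaying (f i)"
  shows "exp_decaying (\<lambda>t. \<Sum>i\<in>I. f i t)"
  using assms
proof (induction I rule: infinite_finite_induct)
  case (insert i I)
  have "exp_decaying (\<lambda>t. f i t - - (\<Sum>i\<in>I. f i t))"
    using insert by (intro exp_decaying_diff exp_decaying_bounded_linear[OF bounded_linear_minus[OF
        bounded_linear_ident]]) auto
  thus ?case using insert by simp
qed (auto intro!: exp_decayingI[of _ 1 0])

lemma exp_decaying_bounded:
  assumes "exp_decaying f"
  obtains K where "\<And>t. 0 \<le> t \<Longrightarrow> norm (f t) \<le> K"
proof -
  obtain K c where K: "0 < c" "0 \<le> K" "\<And>t. 0 \<le> t \<Longrightarrow> norm (f t) \<le> K * exp (- c * t)"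
    using exp_decayingE[OF assms] by metis
  have "norm (f t) \<le> K" if "0 \<le> t" for t
    using order.trans[OF K(3)[OF that] mult_left_mono[of "exp (- c * t)" 1 K]] K that by simp
  thus ?thesis using that by blast
qed

lemma set_integrable_exp_minus:
  assumes "0 < c"
  shows "set_integrable lborel {0..} (\<lambda>t::real. exp (- c * t))"
proof -
  have "(\<integral>\<^sup>+t. ennreal (exp (- c * t)) * indicator {0..} t \<partial>lborel) = ennreal (0 - - exp (- c * 0) / c)"
  proof (rule nn_integral_FTC_atLeast)
    show "((\<lambda>t. - exp (- c * t) / c) has_real_derivative exp (- c * t)) (at t)" for t
      using assms by (auto intro!: derivative_eq_intros)
    show "((\<lambda>t. - exp (- c * t) / c) \<longlongrightarrow> 0) at_top" using assms by real_asymp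
  qed auto
  moreover have "ennreal (norm (indicator {0..} t *\<^sub>R exp (- c * t))) =
      ennreal (exp (- c * t)) * indicator {0..} t" for t :: real
    by (auto simp: indicator_def)
  ultimately have "(\<integral>\<^sup>+t. ennreal (norm (indicator {0..} t *\<^sub>R exp (- c * t))) \<partial>lborel) < \<infinity>"
    by (simp only: ennreal_less_top infinity_ennreal_def)
  thus ?thesis unfolding set_integrable_def by (intro integrableI_bounded) auto
qed

lemma exp_decaying_set_integrable:
  fixes f :: "real \<Rightarrow> 'a::{banach, second_countable_topology}"
  assumes "exp_decaying f"
  shows "set_integrable lborel {0..} f"
proof -
  obtain K c where K: "0 < c" "0 \<le> K" "\<And>t. 0 \<le> t \<Longrightarrow> norm (f t) \<le> K * exp (- c * t)"
    using exp_decayingE[OF assms] by metis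
  have [measurable]: "f \<in> borel_measurable borel"
    using assms by (intro borel_measurable_continuous_onI) (simp add: exp_decaying_def)
  have i: "set_integrable lborel {0..} (\<lambda>t. K * exp (- c * t))"
    using set_integrable_exp_minus[OF K(1)] by (intro set_integrable_mult_right)
  show ?thesis
    unfolding set_integrable_def
    by (rule Bochner_Integration.integrable_bound[OF i[unfolded set_integrable_def]])
      (use K in \<open>auto simp: indicator_def intro!: AE_I2\<close>)
qed

text \<open>The identity on bounded intervals, passed to the limit by dominated convergence. A limit
  \<open>l\<close> other than 0 is allowed, as the cross Gramian requires.\<close>

lemma exp_decaying_integral_FTC:
  fixes f F :: "real \<Rightarrow> 'a::euclidean_space"
  assumes f: "exp_decaying f" and deriv: "\<And>t. (F has_vector_derivative f t) (at t)"
    and lim: "(F \<longlongrightarrow> l) at_top"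
  shows "(LINT t:{0..}|lborel. f t) = l - F 0"
proof (rule LIMSEQ_unique)
  have [measurable]: "f \<in> borel_measurable borel"
    using f by (intro borel_measurable_continuous_onI) (simp add: exp_decaying_def)
  have i: "integrable lborel (\<lambda>t. indicator {0..} t *\<^sub>R f t)"
    using exp_decaying_set_integrable[OF f] by (simp add: set_integrable_def)
  show "(\<lambda>n. LINT t|lborel. indicator {0..real n} t *\<^sub>R f t) \<longlonglongrightarrow> (LINT t:{0..}|lborel. f t)"
    unfolding set_lebesgue_integral_def
  proof (rule integral_dominated_convergence[OF _ _ integrable_norm[OF i]])
    show "AE t in lborel. (\<lambda>n. indicator {0..real n} t *\<^sub>R f t) \<longlonglongrightarrow> indicator {0..} t *\<^sub>R f t"
    proof (intro AE_I2)
      fix t :: real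
      have "eventually (\<lambda>n. indicator {0..real n} t *\<^sub>R f t = indicator {0..} t *\<^sub>R f t) sequentially"
        using eventually_ge_at_top[of "nat \<lceil>t\<rceil>"]
      proof eventually_elim
        case (elim n)
        hence "t \<le> real n" by linarith
        thus ?case by (simp add: indicator_def)
      qed
      thus "(\<lambda>n. indicator {0..real n} t *\<^sub>R f t) \<longlonglongrightarrow> indicator {0..} t *\<^sub>R f t"
        by (rule tendsto_eventually)
    qed
  qed (auto simp: indicator_def intro!: AE_I2)
  have "(LINT t|lborel. indicator {0..real n} t *\<^sub>R f t) = F (real n) - F 0" for n
  proof (rule integral_FTC_Icc)
    show "(F has_vector_derivative f x) (at x within {0..real n})" for x
      by (rule has_vector_derivative_at_within[OF deriv])
    show "continuous_on {0..real n} f"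
      using f by (auto simp: exp_decaying_def intro: continuous_on_subset)
  qed simp
  moreover have "(\<lambda>n. F (real n) - F 0) \<longlonglongrightarrow> l - F 0"
    by (intro tendsto_intros filterlim_compose[OF lim filterlim_real_sequentially])
  ultimately show "(\<lambda>n. LINT t|lborel. indicator {0..real n} t *\<^sub>R f t) \<longlonglongrightarrow> l - F 0"
    by simp
qed

section \<open>Laplace transforms and their energy on vertical lines\<close>

definition laplace_transform :: "(real \<Rightarrow> real) \<Rightarrow> complex \<Rightarrow> complex" where
  "laplace_transform h s = (LINT t:{0..}|lborel. exp (- (s * of_real t)) * of_real (h t))"

lemma exp_decaying_laplace:
  assumes "continuous_on UNIV h" "\<And>t. 0 \<le> t \<Longrightarrow> \<bar>h t\<bar> \<le> K" "0 < Re s"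
  shows "exp_decaying (\<lambda>t. exp (- (s * complex_of_real t)) * complex_of_real (h t))"
  unfolding exp_decaying_def
proof (intro conjI exI allI impI)
  show "continuous_on UNIV (\<lambda>t. exp (- (s * complex_of_real t)) * complex_of_real (h t))"
    by (intro continuous_intros assms(1))
  fix t :: real assume "0 \<le> t"
  thus "norm (exp (- (s * complex_of_real t)) * complex_of_real (h t)) \<le> K * exp (- Re s * t)"
    using assms(2)[of t] by (simp add: norm_mult mult.commute mult_right_mono)
qed (rule assms(3))

lemma laplace_integrable:
  assumes "continuous_on UNIV h" "\<And>t. 0 \<le> t \<Longrightarrow> \<bar>h t\<bar> \<le> K" "0 < Re s"
  shows "set_integrable lborel {0..} (\<lambda>t. exp (- (s * complex_of_real t)) * complex_of_real (h t))"
  by (rule exp_decaying_set_integrable[OF exp_decaying_laplace[OF assms]])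

text \<open>On a vertical line the Laplace transform is the Fourier transform of \<open>g\<close>,
  the response damped by \<open>exp (- \<sigma> * t)\<close> and cut off at negative times, which is
  integrable although \<open>h\<close> is only bounded.\<close>

lemma laplace_transform_plancherel:
  assumes h: "continuous_on UNIV h" "\<And>t. 0 \<le> t \<Longrightarrow> \<bar>h t\<bar> \<le> K" and \<sigma>: "0 < \<sigma>"
  shows "(\<integral>\<^sup>+\<omega>. ennreal ((norm (laplace_transform h (Complex \<sigma> \<omega>)))\<^sup>2) \<partial>lborel) =
    ennreal (2 * pi) * (\<integral>\<^sup>+t\<in>{0..}. ennreal (exp (- 2 * \<sigma> * t) * (h t)\<^sup>2) \<partial>lborel)"
proof -
  define g where "g = (\<lambda>t. indicator {0..} t * (exp (- \<sigma> * t) * h t))"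
  have K: "0 \<le> K" using h(2)[of 0] by simp
  have "exp_decaying (\<lambda>t. exp (- \<sigma> * t) * h t)"
    unfolding exp_decaying_def
  proof (intro conjI exI allI impI)
    show "continuous_on UNIV (\<lambda>t. exp (- \<sigma> * t) * h t)" by (intro continuous_intros h(1))
    show "norm (exp (- \<sigma> * t) * h t) \<le> K * exp (- \<sigma> * t)" if "0 \<le> t" for t
      using h(2)[OF that] by (simp add: abs_mult mult.commute mult_right_mono)
  qed (rule \<sigma>)
  from exp_decaying_set_integrable[OF this] have g: "integrable lborel g"
    by (simp add: g_def set_integrable_def)
  have bound: "\<bar>g t\<bar> \<le> K" for t
  proof (cases "0 \<le> t")
    case True
    have "exp (- \<sigma> * t) * \<bar>h t\<bar> \<le> 1 * K"
      by (intro mult_mono h(2)) (use True \<sigma> in auto)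
    thus ?thesis using True by (simp add: g_def abs_mult)
  qed (simp add: g_def K)
  have cont: "isCont g t" if "t \<noteq> 0" for t
  proof (cases "0 < t")
    case True
    have "eventually (\<lambda>x. g x = exp (- \<sigma> * x) * h x) (nhds t)"
      using eventually_nhds_in_open[of "{0<..}" t] True by (auto simp: g_def elim!: eventually_mono)
    moreover have "isCont (\<lambda>x. exp (- \<sigma> * x) * h x) t"
      using h(1) by (intro continuous_intros) (simp add: continuous_on_eq_continuous_at)
    ultimately show ?thesis using isCont_cong by metis
  next
    case False
    have "eventually (\<lambda>x. g x = 0) (nhds t)"
      using eventually_nhds_in_open[of "{..<0}" t] False that by (auto simp: g_def elim!: eventually_mono)
    thus ?thesis using isCont_cong[of g "\<lambda>_. 0" t] by simp
  qed
  have "(norm (laplace_transform h (Complex \<sigma> \<omega>)))\<^sup>2 =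
      (LINT t|lborel. g t * cos (\<omega> * t))\<^sup>2 + (LINT t|lborel. g t * sin (\<omega> * t))\<^sup>2" for \<omega>
  proof -
    let ?f = "\<lambda>t. indicator {0..} t *\<^sub>R (exp (- (Complex \<sigma> \<omega> * complex_of_real t)) * complex_of_real (h t))"
    have i: "integrable lborel ?f"
      using laplace_integrable[OF h, of "Complex \<sigma> \<omega>"] \<sigma> by (simp add: set_integrable_def)
    have "Re (?f t) = g t * cos (\<omega> * t)" "Im (?f t) = - (g t * sin (\<omega> * t))" for t
      by (simp_all add: g_def Re_exp Im_exp)
    hence "Re (integral\<^sup>L lborel ?f) = (LINT t|lborel. g t * cos (\<omega> * t))"
      "Im (integral\<^sup>L lborel ?f) = - (LINT t|lborel. g t * sin (\<omega> * t))"
      using integral_Re[OF i] integral_Im[OF i] by simp_all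
    thus ?thesis by (simp add: laplace_transform_def set_lebesgue_integral_def cmod_power2)
  qed
  moreover have "(g t)\<^sup>2 = exp (- 2 * \<sigma> * t) * (h t)\<^sup>2 * indicator {0..} t" for t
    by (simp add: g_def power_mult_distrib exp_double[symmetric] power2_eq_square indicator_def
        exp_add[symmetric])
  hence "ennreal ((g t)\<^sup>2) = ennreal (exp (- 2 * \<sigma> * t) * (h t)\<^sup>2) * indicator {0..} t" for t
    by (simp add: indicator_def)
  ultimately show ?thesis using plancherel_real[OF g bound cont] by simp
qed

section \<open>Transfer functions\<close>

lemma norm_matrix_square:
  fixes X :: "'a::real_normed_vector^'p^'q"
  shows "(norm X)\<^sup>2 = (\<Sum>i\<in>UNIV. \<Sum>j\<in>UNIV. (norm (X $ i $ j))\<^sup>2)"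
  by (simp add: norm_vec_def L2_set_def sum_nonneg)

lemma norm_matrix_square_trace:
  fixes X :: "real^'p^'q"
  shows "(norm X)\<^sup>2 = trace (X ** transpose X)"
  unfolding norm_matrix_square
  by (simp add: trace_def matrix_matrix_mult_def transpose_def) (simp add: power2_eq_square)

text \<open>Monotone convergence along \<open>\<sigma> n = 1 / Suc n\<close>; this removes the
  damping from the supremum over vertical lines.\<close>

lemma SUP_exp_weight:
  fixes f :: "real \<Rightarrow> ennreal"
  assumes [measurable]: "f \<in> borel_measurable borel"
  shows "(SUP \<sigma>\<in>{0<..}. \<integral>\<^sup>+t\<in>{0..}. ennreal (exp (- 2 * \<sigma> * t)) * f t \<partial>lborel) =
    (\<integral>\<^sup>+t\<in>{0..}. f t \<partial>lborel)"
proof (rule antisym)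
  show "(SUP \<sigma>\<in>{0<..}. \<integral>\<^sup>+t\<in>{0..}. ennreal (exp (- 2 * \<sigma> * t)) * f t \<partial>lborel) \<le>
      (\<integral>\<^sup>+t\<in>{0..}. f t \<partial>lborel)"
  proof (intro SUP_least nn_integral_mono)
    fix \<sigma> t :: real assume "\<sigma> \<in> {0<..}"
    hence "ennreal (exp (- 2 * \<sigma> * t)) * f t \<le> 1 * f t" if "0 \<le> t"
      using that by (intro mult_right_mono) (auto simp: ennreal_le_1)
    thus "ennreal (exp (- 2 * \<sigma> * t)) * f t * indicator {0..} t \<le> f t * indicator {0..} t"
      by (auto simp: indicator_def)
  qed
  define \<sigma> where "\<sigma> = (\<lambda>n. 1 / real (Suc n))"
  have \<sigma>: "0 < \<sigma> n" for n by (simp add: \<sigma>_def)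
  have \<sigma>0: "\<sigma> \<longlonglongrightarrow> 0" unfolding \<sigma>_def by (rule LIMSEQ_Suc) (rule lim_1_over_n)
  have "(\<lambda>n. \<integral>\<^sup>+t\<in>{0..}. ennreal (exp (- 2 * \<sigma> n * t)) * f t \<partial>lborel) \<longlonglongrightarrow> (\<integral>\<^sup>+t\<in>{0..}. f t \<partial>lborel)"
  proof (rule nn_integral_LIMSEQ)
    show "incseq (\<lambda>n t. ennreal (exp (- 2 * \<sigma> n * t)) * f t * indicator {0..} t)"
    proof (intro incseq_SucI le_funI)
      fix n and t :: real
      have "\<sigma> (Suc n) \<le> \<sigma> n" unfolding \<sigma>_def by (intro divide_left_mono) auto
      hence "exp (- 2 * \<sigma> n * t) \<le> exp (- 2 * \<sigma> (Suc n) * t)" if "0 \<le> t"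
        using that by (simp add: mult_right_mono)
      thus "ennreal (exp (- 2 * \<sigma> n * t)) * f t * indicator {0..} t
          \<le> ennreal (exp (- 2 * \<sigma> (Suc n) * t)) * f t * indicator {0..} t"
        by (auto simp: indicator_def intro!: mult_right_mono ennreal_leI)
    qed
    fix t :: real
    have "(\<lambda>n. exp (- 2 * \<sigma> n * t)) \<longlonglongrightarrow> exp (- 2 * 0 * t)" by (intro tendsto_intros \<sigma>0)
    hence "(\<lambda>n. ennreal (exp (- 2 * \<sigma> n * t))) \<longlonglongrightarrow> ennreal 1" by (intro tendsto_ennrealI) simp
    hence "(\<lambda>n. (f t * indicator {0..} t) * ennreal (exp (- 2 * \<sigma> n * t))) \<longlonglongrightarrow> (f t * indicator {0..} t) *
        ennreal 1"
      by (intro tendsto_mult_ennreal tendsto_const) auto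
    thus "(\<lambda>n. ennreal (exp (- 2 * \<sigma> n * t)) * f t * indicator {0..} t) \<longlonglongrightarrow> f t * indicator {0..} t"
      by (simp add: ac_simps)
  qed measurable
  thus "(\<integral>\<^sup>+t\<in>{0..}. f t \<partial>lborel) \<le>
      (SUP \<sigma>\<in>{0<..}. \<integral>\<^sup>+t\<in>{0..}. ennreal (exp (- 2 * \<sigma> * t)) * f t \<partial>lborel)"
    by (rule LIMSEQ_le_const2) (use \<sigma> in \<open>auto intro!: SUP_upper\<close>)
qed

text \<open>The squared Frobenius norm splits into entries, so scalar Plancherel applies to each of
  them before the supremum is taken.\<close>

lemma h2_square_laplace:
  fixes h :: "real \<Rightarrow> real^'p^'q" and G :: "complex \<Rightarrow> complex^'p^'q"
  assumes h: "continuous_on UNIV h" "\<And>t. 0 \<le> t \<Longrightarrow> norm (h t) \<le> K"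
    and G: "\<And>s i j. 0 < Re s \<Longrightarrow> G s $ i $ j = laplace_transform (\<lambda>t. h t $ i $ j) s"
  shows "h2_square G = (\<integral>\<^sup>+t\<in>{0..}. ennreal ((norm (h t))\<^sup>2) \<partial>lborel)"
proof -
  have c: "continuous_on UNIV (\<lambda>t. h t $ i $ j)" for i j
    by (intro continuous_intros h(1))
  have b: "\<bar>h t $ i $ j\<bar> \<le> K" if "0 \<le> t" for t i j
    using h(2)[OF that] Finite_Cartesian_Product.norm_nth_le[of "h t" i]
        Finite_Cartesian_Product.norm_nth_le[of "h t $ i" j] by simp
  have [measurable]: "(\<lambda>t. h t $ i $ j) \<in> borel_measurable borel" for i j
    by (rule borel_measurable_continuous_onI[OF c])
  have [measurable]: "h \<in> borel_measurable borel"
    by (rule borel_measurable_continuous_onI[OF h(1)])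
  have "ennreal (1 / (2 * pi)) * (\<integral>\<^sup>+ \<omega>. ennreal ((norm (G (Complex \<sigma> \<omega>)))\<^sup>2) \<partial>lborel) =
      (\<integral>\<^sup>+t\<in>{0..}. ennreal (exp (- 2 * \<sigma> * t)) * ennreal ((norm (h t))\<^sup>2) \<partial>lborel)" if "0 < \<sigma>" for \<sigma>
  proof -
    let ?L = "\<lambda>i j \<omega>. laplace_transform (\<lambda>t. h t $ i $ j) (Complex \<sigma> \<omega>)"
    have [measurable]: "?L i j \<in> borel_measurable borel" for i j
      unfolding laplace_transform_def set_lebesgue_integral_def Complex_eq by measurable
    define e where "e = (\<lambda>i j t. ennreal (exp (- 2 * \<sigma> * t) * (h t $ i $ j)\<^sup>2) * indicator {0..} t)"
    have [measurable]: "e i j \<in> borel_measurable borel" for i j unfolding e_def by measurable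
    have "(\<integral>\<^sup>+ \<omega>. ennreal ((norm (G (Complex \<sigma> \<omega>)))\<^sup>2) \<partial>lborel) =
        (\<integral>\<^sup>+ \<omega>. (\<Sum>i\<in>UNIV. \<Sum>j\<in>UNIV. ennreal ((norm (?L i j \<omega>))\<^sup>2)) \<partial>lborel)"
      by (intro nn_integral_cong) (use that in \<open>simp add: norm_matrix_square G sum_nonneg\<close>)
    also have "\<dots> = (\<Sum>i\<in>UNIV. \<Sum>j\<in>UNIV. \<integral>\<^sup>+ \<omega>. ennreal ((norm (?L i j \<omega>))\<^sup>2) \<partial>lborel)"
      by (simp add: nn_integral_sum del: sum_ennreal)
    also have "\<dots> = (\<Sum>i\<in>UNIV. \<Sum>j\<in>UNIV. ennreal (2 * pi) *
        (\<integral>\<^sup>+t\<in>{0..}. ennreal (exp (- 2 * \<sigma> * t) * (h t $ i $ j)\<^sup>2) \<partial>lborel))"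
      by (intro sum.cong refl laplace_transform_plancherel[OF c b that])
    also have "\<dots> = (\<Sum>i\<in>UNIV. \<Sum>j\<in>UNIV. ennreal (2 * pi) * (\<integral>\<^sup>+t. e i j t \<partial>lborel))"
      by (simp add: e_def)
    also have "\<dots> = ennreal (2 * pi) * (\<integral>\<^sup>+t. (\<Sum>i\<in>UNIV. \<Sum>j\<in>UNIV. e i j t) \<partial>lborel)"
      by (simp add: nn_integral_sum sum_distrib_left)
    also have "(\<integral>\<^sup>+t. (\<Sum>i\<in>UNIV. \<Sum>j\<in>UNIV. e i j t) \<partial>lborel) =
        (\<integral>\<^sup>+t\<in>{0..}. ennreal (exp (- 2 * \<sigma> * t)) * ennreal ((norm (h t))\<^sup>2) \<partial>lborel)"
    proof (rule nn_integral_cong)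
      fix t
      have "(\<Sum>i\<in>UNIV. \<Sum>j\<in>UNIV. ennreal (exp (- 2 * \<sigma> * t) * (h t $ i $ j)\<^sup>2)) =
          ennreal (exp (- 2 * \<sigma> * t) * (norm (h t))\<^sup>2)"
        by (simp add: norm_matrix_square sum_nonneg sum_distrib_left)
      thus "(\<Sum>i\<in>UNIV. \<Sum>j\<in>UNIV. e i j t) =
          ennreal (exp (- 2 * \<sigma> * t)) * ennreal ((norm (h t))\<^sup>2) * indicator {0..} t"
        by (cases "0 \<le> t") (simp_all add: e_def ennreal_mult)
    qed
    finally have "(\<integral>\<^sup>+ \<omega>. ennreal ((norm (G (Complex \<sigma> \<omega>)))\<^sup>2) \<partial>lborel) = ennreal (2 * pi) *
        (\<integral>\<^sup>+t\<in>{0..}. ennreal (exp (- 2 * \<sigma> * t)) * ennreal ((norm (h t))\<^sup>2) \<partial>lborel)" .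
    moreover have "ennreal (1 / (2 * pi)) * ennreal (2 * pi) = 1"
      by (subst ennreal_mult[symmetric]) auto
    ultimately show ?thesis by (simp add: mult.assoc[symmetric])
  qed
  hence "h2_square G = (SUP \<sigma>\<in>{0<..}. \<integral>\<^sup>+t\<in>{0..}. ennreal (exp (- 2 * \<sigma> * t)) * ennreal ((norm (h t))\<^sup>2)
      \<partial>lborel)"
    unfolding h2_square_def by (intro SUP_cong) auto
  also have "\<dots> = (\<integral>\<^sup>+t\<in>{0..}. ennreal ((norm (h t))\<^sup>2) \<partial>lborel)"
    by (rule SUP_exp_weight) measurable
  finally show ?thesis .
qed

abbreviation complex_matrix :: "real^'n^'m \<Rightarrow> complex^'n^'m" where
  "complex_matrix \<equiv> map_matrix of_real"

definition laplace_matrix_exp :: "real^'n^'n \<Rightarrow> complex \<Rightarrow> complex^'n^'n" where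
  "laplace_matrix_exp A s = (\<chi> i j. laplace_transform (\<lambda>t. matrix_exp (t *\<^sub>R A) $ i $ j) s)"

text \<open>Integrating the derivative of \<open>exp (- s t)\<close> times the semigroup over the
  half-line leaves the value at 0, the identity. Boundedness of the semigroup suffices, as
  \<open>Re s > 0\<close> supplies the decay.\<close>

lemma resolvent_eq_laplace:
  fixes A :: "real^'n^'n"
  assumes bound: "\<And>t. 0 \<le> t \<Longrightarrow> norm (matrix_exp (t *\<^sub>R A)) \<le> K" and s: "0 < Re s"
  shows "(mat s - complex_matrix A) ** laplace_matrix_exp A s = mat 1"
proof -
  have c: "continuous_on UNIV (\<lambda>t. matrix_exp (t *\<^sub>R A) $ i $ j)" for i j
    by (intro continuous_intros)
  have b: "\<bar>matrix_exp (t *\<^sub>R A) $ i $ j\<bar> \<le> K" if "0 \<le> t" for t i j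
    using bound[OF that] Finite_Cartesian_Product.norm_nth_le[of "matrix_exp (t *\<^sub>R A)" i]
        Finite_Cartesian_Product.norm_nth_le[of "matrix_exp (t *\<^sub>R A) $ i" j]
    by simp
  let ?T = "\<lambda>i j t. matrix_exp (t *\<^sub>R A) $ i $ j"
  let ?e = "\<lambda>t. exp (- (s * complex_of_real t))"
  let ?F = "\<lambda>i j t. ?e t * of_real (?T i j t)"
  have dec: "exp_decaying (?F i j)" for i j
    by (rule exp_decaying_laplace[OF c b s])
  have "((mat s - complex_matrix A) ** laplace_matrix_exp A s) $ i $ j = mat 1 $ i $ j" for i j
  proof -
    have "((mat s - complex_matrix A) ** laplace_matrix_exp A s) $ i $ j =
        s * laplace_matrix_exp A s $ i $ j - (\<Sum>k\<in>UNIV. of_real (A $ i $ k) * laplace_matrix_exp A s $ k $ j)"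
    proof -
      have "(mat s ** X) $ i $ j = s * X $ i $ j" for X :: "complex^'n^'n"
        by (simp add: matrix_matrix_mult_def mat_def if_distrib[of "\<lambda>x. x * _"] sum.delta cong: if_cong)
      moreover have "(B - B') ** X = B ** X - B' ** X" for B B' X :: "complex^'n^'n"
        by (simp add: matrix_matrix_mult_def vec_eq_iff left_diff_distrib sum_subtractf)
      moreover have "(complex_matrix A ** X) $ i $ j = (\<Sum>k\<in>UNIV. of_real (A $ i $ k) * X $ k $ j)" for X ::
          "complex^'n^'n"
        by (simp add: matrix_matrix_mult_def map_matrix_def)
      ultimately show ?thesis by (simp only: vector_minus_component)
    qed
    also have "\<dots> = (LINT t:{0..}|lborel. s * ?F i j t - (\<Sum>k\<in>UNIV. of_real (A $ i $ k) * ?F k j t))"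
    proof -
      define f where "f = (\<lambda>k t. indicator {0..} t *\<^sub>R ?F k j t)"
      have int: "integrable lborel (f k)" for k
        using exp_decaying_set_integrable[OF dec[of k j]] by (simp add: set_integrable_def f_def)
      have "s * integral\<^sup>L lborel (f i) - (\<Sum>k\<in>UNIV. of_real (A $ i $ k) * integral\<^sup>L lborel (f k)) =
          (LINT t|lborel. s * f i t - (\<Sum>k\<in>UNIV. of_real (A $ i $ k) * f k t))"
        using int by simp
      also have "\<dots> = (LINT t|lborel. indicator {0..} t *\<^sub>R
          (s * ?F i j t - (\<Sum>k\<in>UNIV. of_real (A $ i $ k) * ?F k j t)))"
      proof (rule Bochner_Integration.integral_cong[OF refl])
        show "s * f i t - (\<Sum>k\<in>UNIV. of_real (A $ i $ k) * f k t) =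
            indicator {0..} t *\<^sub>R (s * ?F i j t - (\<Sum>k\<in>UNIV. of_real (A $ i $ k) * ?F k j t))" for t
          by (cases "0 \<le> t") (simp_all add: f_def)
      qed
      finally show ?thesis
        by (simp only: laplace_matrix_exp_def laplace_transform_def set_lebesgue_integral_def f_def
            vec_lambda_beta)
    qed
    \<comment> \<open>After the sign change the integrand is exactly the derivative of
      \<open>?F i j\<close>.\<close>
    also have "\<dots> = - (LINT t:{0..}|lborel. - s * ?F i j t + (\<Sum>k\<in>UNIV. of_real (A $ i $ k) * ?F k j t))"
      unfolding set_lebesgue_integral_def
      by (subst integral_minus[symmetric]) (simp add: scaleR_diff_right scaleR_add_right)
    also have "(LINT t:{0..}|lborel. - s * ?F i j t + (\<Sum>k\<in>UNIV. of_real (A $ i $ k) * ?F k j t)) = 0 - ?F i j 0"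
    proof (rule exp_decaying_integral_FTC)
      have "exp_decaying (\<lambda>t. (\<Sum>k\<in>UNIV. of_real (A $ i $ k) * ?F k j t) - s * ?F i j t)"
        by (intro exp_decaying_diff exp_decaying_sum exp_decaying_bounded_linear[OF
            bounded_linear_mult_right] dec)
      thus "exp_decaying (\<lambda>t. - s * ?F i j t + (\<Sum>k\<in>UNIV. of_real (A $ i $ k) * ?F k j t))"
        by simp
      have e: "(?e has_vector_derivative (- s * ?e t)) (at t)" for t
      proof -
        have "((\<lambda>z. exp (- (s * z))) has_field_derivative (- s * ?e t)) (at (of_real t))"
          by (auto intro!: derivative_eq_intros)
        from has_vector_derivative_real_field[OF this] show ?thesis .
      qed
      have T: "((\<lambda>t. complex_of_real (?T i j t)) has_vector_derivative of_real ((A ** matrix_exp (t *\<^sub>R A))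
          $ i $ j)) (at t)" for t
        by (intro bounded_linear.has_vector_derivative[OF bounded_linear_of_real]
            bounded_linear.has_vector_derivative[OF bounded_linear_vec_nth]
            matrix_exp_has_vector_derivative)
      show "(?F i j has_vector_derivative (- s * ?F i j t + (\<Sum>k\<in>UNIV. of_real (A $ i $ k) * ?F k j t))) (at
          t)" for t
        using has_vector_derivative_mult[OF e T, of t]
        by (simp add: matrix_matrix_mult_def sum_distrib_left ac_simps)
      obtain L c where L: "0 < c" "0 \<le> L" "\<And>t. 0 \<le> t \<Longrightarrow> norm (?F i j t) \<le> L * exp (- c * t)"
        using exp_decayingE[OF dec[of i j]] by metis
      show "(?F i j \<longlongrightarrow> 0) at_top" by (rule norm_exp_decay_tendsto_0[OF L(1,3)])
    qed
    finally show ?thesis by (simp add: mat_def)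
  qed
  thus ?thesis by (simp add: vec_eq_iff)
qed

lemma holomorphic_on_det [holomorphic_intros]:
  assumes "\<And>i j. (\<lambda>s. X s $ i $ j) holomorphic_on S"
  shows "(\<lambda>s. det (X s)) holomorphic_on S"
  unfolding det_def by (intro holomorphic_intros assms)

lemma transfer_function_entry:
  fixes A :: "real^'n^'n" and B :: "real^'p^'n" and C :: "real^'n^'q"
  assumes bound: "\<And>t. 0 \<le> t \<Longrightarrow> norm (matrix_exp (t *\<^sub>R A)) \<le> K" and s: "0 < Re s"
  shows "transfer_function A B C s $ i $ j = laplace_transform (\<lambda>t. (C ** matrix_exp (t *\<^sub>R A) ** B) $ i $ j) s"
proof -
  have inv: "matrix_inv (mat s - complex_matrix A) = laplace_matrix_exp A s"
    by (rule matrix_inv_eqI[OF resolvent_eq_laplace[OF bound s]])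
  have c: "continuous_on UNIV (\<lambda>t. matrix_exp (t *\<^sub>R A) $ i $ j)" for i j
    by (intro continuous_intros)
  have b: "\<bar>matrix_exp (t *\<^sub>R A) $ i $ j\<bar> \<le> K" if "0 \<le> t" for t i j
    using bound[OF that] Finite_Cartesian_Product.norm_nth_le[of "matrix_exp (t *\<^sub>R A)" i]
        Finite_Cartesian_Product.norm_nth_le[of "matrix_exp (t *\<^sub>R A) $ i" j]
    by simp
  define f where "f = (\<lambda>k l t. indicator {0..} t *\<^sub>R
      (exp (- (s * complex_of_real t)) * complex_of_real (matrix_exp (t *\<^sub>R A) $ k $ l)))"
  have int: "integrable lborel (f k l)" for k l
    using laplace_integrable[OF c b s] by (simp add: set_integrable_def f_def)
  have "transfer_function A B C s $ i $ j =
      (\<Sum>l\<in>UNIV. (\<Sum>k\<in>UNIV. of_real (C $ i $ k) * laplace_matrix_exp A s $ k $ l) * of_real (B $ l $ j))"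
    unfolding transfer_function_def inv by (simp add: matrix_matrix_mult_def map_matrix_def)
  also have "\<dots> = (\<Sum>l\<in>UNIV. (\<Sum>k\<in>UNIV. of_real (C $ i $ k) * integral\<^sup>L lborel (f k l)) * of_real (B $ l $ j))"
    by (simp add: laplace_matrix_exp_def laplace_transform_def set_lebesgue_integral_def f_def)
  also have "\<dots> = (LINT t|lborel. (\<Sum>l\<in>UNIV. (\<Sum>k\<in>UNIV. of_real (C $ i $ k) * f k l t) * of_real (B $ l $ j)))"
    using int by simp
  also have "\<dots> = laplace_transform (\<lambda>t. (C ** matrix_exp (t *\<^sub>R A) ** B) $ i $ j) s"
    unfolding laplace_transform_def set_lebesgue_integral_def
  proof (intro Bochner_Integration.integral_cong refl)
    fix t
    show "(\<Sum>l\<in>UNIV. (\<Sum>k\<in>UNIV. of_real (C $ i $ k) * f k l t) * of_real (B $ l $ j)) =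
        indicator {0..} t *\<^sub>R (exp (- (s * complex_of_real t)) * complex_of_real ((C ** matrix_exp (t *\<^sub>R
            A) ** B) $ i $ j))"
      by (cases "0 \<le> t")
        (simp_all add: f_def matrix_matrix_mult_def sum_distrib_left sum_distrib_right ac_simps)
  qed
  finally show ?thesis .
qed

text \<open>Cramer's rule writes the entries of the resolvent as quotients of determinants with
  holomorphic entries; the denominator has no zeros because an inverse exists on the
  half-plane.\<close>

lemma transfer_function_holomorphic:
  fixes A :: "real^'n^'n" and B :: "real^'p^'n" and C :: "real^'n^'q"
  assumes bound: "\<And>t. 0 \<le> t \<Longrightarrow> norm (matrix_exp (t *\<^sub>R A)) \<le> K"
  shows "(\<lambda>s. transfer_function A B C s $ i $ j) holomorphic_on {s. 0 < Re s}"
proof -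
  let ?X = "\<lambda>s. mat s - complex_matrix A"
  let ?Y = "\<lambda>s k l. det (\<chi> i j. if j = k then axis l 1 $ i else ?X s $ i $ j) / det (?X s)"
  have det: "det (?X s) \<noteq> 0" if "0 < Re s" for s
    using resolvent_eq_laplace[OF bound that] by (metis det_I det_mul mult_zero_left zero_neq_one)
  have X: "(\<lambda>s. ?X s $ i $ j) holomorphic_on S" for i j S
    by (cases "i = j") (auto simp: mat_def intro!: holomorphic_intros)
  have inv: "matrix_inv (?X s) $ k $ l = ?Y s k l" if "0 < Re s" for s k l
  proof -
    have "?X s ** matrix_inv (?X s) = mat 1"
      using resolvent_eq_laplace[OF bound that] matrix_inv_eqI by metis
    hence "?X s *v (matrix_inv (?X s) *v axis l 1) = axis l 1"
      by (simp only: matrix_vector_mul_assoc matrix_vector_mul_lid)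
    hence "matrix_inv (?X s) *v axis l 1 = (\<chi> k. ?Y s k l)"
      using cramer[OF det[OF that]] by blast
    moreover have "(matrix_inv (?X s) *v axis l 1) $ k = matrix_inv (?X s) $ k $ l"
      by (simp add: matrix_vector_mult_def axis_def if_distrib[of "\<lambda>x. _ * x"] cong: if_cong)
    ultimately show ?thesis by simp
  qed
  have Y: "(\<lambda>s. ?Y s k l) holomorphic_on {s. 0 < Re s}" for k l
  proof (intro holomorphic_on_divide holomorphic_on_det)
    show "(\<lambda>s. (\<chi> i j. if j = k then axis l 1 $ i else ?X s $ i $ j) $ a $ b) holomorphic_on {s. 0 < Re s}"
        for a b
      using X by (cases "b = k") (auto intro!: holomorphic_intros)
  qed (use X det in auto)
  have "(\<lambda>s. \<Sum>l\<in>UNIV. (\<Sum>k\<in>UNIV. of_real (C $ i $ k) * ?Y s k l) * of_real (B $ l $ j)) holomorphic_on {s. 0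
      < Re s}"
    by (intro holomorphic_intros Y)
  moreover have "transfer_function A B C s $ i $ j =
      (\<Sum>l\<in>UNIV. (\<Sum>k\<in>UNIV. of_real (C $ i $ k) * ?Y s k l) * of_real (B $ l $ j))" if "0 < Re s" for s
    unfolding transfer_function_def using inv[OF that] by (simp add: matrix_matrix_mult_def map_matrix_def)
  ultimately show ?thesis by (subst holomorphic_cong[OF refl]) auto
qed

section \<open>Gramians and the error norm\<close>

lemma exp_decaying_matrix_exp:
  assumes "zero_row_sum_Z_matrix A"
  shows "exp_decaying (\<lambda>t. matrix_exp (t *\<^sub>R (- A)) - exp_limit (- A))"
proof -
  obtain K c where K: "0 < c"
    "\<And>t. 0 \<le> t \<Longrightarrow> norm (matrix_exp (t *\<^sub>R (- A)) - exp_limit (- A)) \<le> K * exp (- c * t)"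
    using exp_limit_decay[OF assms] by metis
  show ?thesis by (rule exp_decayingI[OF _ K]) (intro continuous_intros)
qed

lemma matrix_exp_bounded:
  assumes "zero_row_sum_Z_matrix A"
  obtains K where "\<And>t. 0 \<le> t \<Longrightarrow> norm (matrix_exp (t *\<^sub>R (- A))) \<le> K"
proof -
  obtain K where K: "\<And>t. 0 \<le> t \<Longrightarrow> norm (matrix_exp (t *\<^sub>R (- A)) - exp_limit (- A)) \<le> K"
    using exp_decaying_bounded[OF exp_decaying_matrix_exp[OF assms]] by metis
  have "norm (matrix_exp (t *\<^sub>R (- A))) \<le> K + norm (exp_limit (- A))" if "0 \<le> t" for t
    using norm_triangle_sub[of "matrix_exp (t *\<^sub>R (- A))" "exp_limit (- A)"] K[OF that] by simp
  thus ?thesis using that by blast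
qed

lemma set_integral_bounded_linear:
  fixes f :: "'a \<Rightarrow> 'b::{banach, second_countable_topology}" and F :: "'b \<Rightarrow> 'c::{banach,
      second_countable_topology}"
  assumes "bounded_linear F" "set_integrable M S f"
  shows "(LINT t:S|M. F (f t)) = F (LINT t:S|M. f t)"
  using integral_bounded_linear[OF assms(1), of M "\<lambda>t. indicator S t *\<^sub>R f t"] assms(2)
  by (simp add: set_lebesgue_integral_def set_integrable_def linear_scale[OF bounded_linear.linear[OF
      assms(1)]])

lemma transpose_diff: "transpose (A - B) = transpose A - transpose (B :: real^'n^'m)"
  by (simp add: transpose_def vec_eq_iff)

text \<open>Exponential decay makes the integrand absolutely integrable, so the gauge integral of
  the definition agrees with a Lebesgue integral.\<close>

lemma pseudo_ctrb_gramian_eq: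
  fixes A :: "real^'n^'n" and B :: "real^'p^'n"
  assumes A: "zero_row_sum_Z_matrix A"
  defines "a \<equiv> \<lambda>t. (matrix_exp (t *\<^sub>R (- A)) - exp_limit (- A)) ** B"
  shows "pseudo_ctrb_gramian (- A) B = (LINT t:{0..}|lborel. a t ** transpose (a t))"
proof -
  have "exp_decaying a"
    unfolding a_def
    by (rule exp_decaying_bounded_linear[OF matmul.bounded_linear_left exp_decaying_matrix_exp[OF A]])
  hence "exp_decaying (\<lambda>t. a t ** transpose (a t))"
    by (intro exp_decaying_bounded_bilinear[OF bounded_bilinear_matrix_mult]
        exp_decaying_bounded_linear[OF bounded_linear_transpose])
  hence "set_integrable lborel {0..} (\<lambda>t. a t ** transpose (a t))"
    by (rule exp_decaying_set_integrable)
  from set_borel_integral_eq_integral(2)[OF this] show ?thesis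
    by (simp add: pseudo_ctrb_gramian_def a_def matrix_exp_transpose matrix_transpose_mul transpose_diff
        matrix_mul_assoc)
qed

text \<open>
  For a solution \<open>P\<close> of the Sylvester equation, the cross Gramian integrand is minus the derivative of
  \<open>exp (- Ar t) P exp (- A t)\<^sup>T\<close>, whose limit accounts for the correction term.
\<close>

lemma cross_gramian:
  fixes A :: "real^'n^'n" and Ar :: "real^'r^'r" and D :: "real^'n^'r"
  assumes A: "zero_row_sum_Z_matrix A" and Ar: "zero_row_sum_Z_matrix Ar"
    and comm: "D ** exp_limit (- A) = exp_limit (- Ar) ** D"
    and sylvester: "Ar ** P + P ** transpose A
        - D ** (mat 1 - exp_limit (- A)) ** F ** transpose F ** (mat 1 - transpose (exp_limit (- A))) = 0"
  shows "(LINT t:{0..}|lborel. ((matrix_exp (t *\<^sub>R (- Ar)) - exp_limit (- Ar)) ** (D ** F)) **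
        transpose ((matrix_exp (t *\<^sub>R (- A)) - exp_limit (- A)) ** F)) =
      P - exp_limit (- Ar) ** P ** transpose (exp_limit (- A))"
proof -
  let ?T = "\<lambda>t. matrix_exp (t *\<^sub>R (- A))" and ?Tr = "\<lambda>t. matrix_exp (t *\<^sub>R (- Ar))"
  let ?J = "exp_limit (- A)" and ?Jr = "exp_limit (- Ar)"
  let ?f = "\<lambda>t. ((?Tr t - ?Jr) ** (D ** F)) ** transpose ((?T t - ?J) ** F)"
  have TJ: "?T t ** ?J = ?J" for t by (rule matrix_exp_right_kernel[OF exp_limit_mult_self(1)[OF A]])
  have TrJr: "?Tr t ** ?Jr = ?Jr" for t by (rule matrix_exp_right_kernel[OF exp_limit_mult_self(1)[OF Ar]])
  have dec: "exp_decaying ?f"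
    by (intro exp_decaying_bounded_bilinear[OF bounded_bilinear_matrix_mult]
        exp_decaying_bounded_linear[OF bounded_linear_transpose]
        exp_decaying_bounded_linear[OF matmul.bounded_linear_left] exp_decaying_matrix_exp A Ar)
  have f_eq: "?f t = ?Tr t ** (Ar ** P + P ** transpose A) ** transpose (?T t)" for t
  proof -
    have "?Tr t ** (Ar ** P + P ** transpose A) ** transpose (?T t) =
        (?Tr t ** (D ** (mat 1 - ?J))) ** F ** transpose F ** ((mat 1 - transpose ?J) ** transpose (?T t))"
      using sylvester by (simp add: matrix_mul_assoc)
    \<comment> \<open>\<open>comm\<close> carries the projection to the left of \<open>D\<close>,
      where the reduced semigroup leaves \<open>?Jr\<close> fixed.\<close>
    also have "?Tr t ** (D ** (mat 1 - ?J)) = (?Tr t - ?Jr) ** D"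
      by (simp add: matmul.diff_right matmul.diff_left comm) (simp add: matrix_mul_assoc TrJr)
    also have "(mat 1 - transpose ?J) ** transpose (?T t) = transpose (?T t - ?J)"
      using TJ[of t] by (simp add: matmul.diff_left transpose_diff flip: matrix_transpose_mul)
    finally show ?thesis by (simp add: matrix_transpose_mul matrix_mul_assoc)
  qed
  have deriv: "((\<lambda>t. - (?Tr t ** P ** transpose (?T t))) has_vector_derivative ?f t) (at t)" for t
  proof -
    have "((\<lambda>t. ?Tr t ** P ** transpose (?T t)) has_vector_derivative
        (?Tr t ** P) ** transpose (- A ** ?T t) + ((- Ar ** ?Tr t) ** P) ** transpose (?T t)) (at t)"
      by (intro matmul.has_vector_derivative matrix_exp_has_vector_derivative
          bounded_linear.has_vector_derivative[OF matmul.bounded_linear_left]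
          bounded_linear.has_vector_derivative[OF bounded_linear_transpose])
    moreover have "(?Tr t ** P) ** transpose (- A ** ?T t) + ((- Ar ** ?Tr t) ** P) ** transpose (?T t) = -
        ?f t"
      unfolding f_eq matrix_exp_commute
      by (simp add: matrix_transpose_mul matmul.add_left matmul.add_right matmul.minus_left matmul.minus_right
          linear_neg[OF bounded_linear.linear[OF bounded_linear_transpose]] matrix_mul_assoc)
    ultimately show ?thesis using has_vector_derivative_minus by fastforce
  qed
  have lim: "((\<lambda>t. - (?Tr t ** P ** transpose (?T t))) \<longlongrightarrow> - (?Jr ** P ** transpose ?J)) at_top"
    by (intro tendsto_minus matmul.tendsto bounded_linear.tendsto[OF bounded_linear_transpose]
        matrix_exp_tendsto_exp_limit A Ar tendsto_const)
  from exp_decaying_integral_FTC[OF dec deriv lim] show ?thesis by simp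
qed

lemma laplace_transform_diff:
  assumes "continuous_on UNIV f" "\<And>t. 0 \<le> t \<Longrightarrow> \<bar>f t\<bar> \<le> K"
    and "continuous_on UNIV g" "\<And>t. 0 \<le> t \<Longrightarrow> \<bar>g t\<bar> \<le> L" and s: "0 < Re s"
  shows "laplace_transform (\<lambda>t. f t - g t) s = laplace_transform f s - laplace_transform g s"
  using set_integral_diff(2)[OF laplace_integrable[OF assms(1,2) s] laplace_integrable[OF assms(3,4) s]]
  by (simp add: laplace_transform_def right_diff_distrib)

lemma trace_transpose: "trace (transpose A) = trace A"
  by (simp add: trace_def transpose_def)

lemma linear_trace_congruence: "bounded_linear (\<lambda>X. trace (B ** X ** C :: real^'n^'n))"
proof -
  have "linear (trace :: real^'n^'n \<Rightarrow> real)"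
    by (rule linearI) (simp_all add: trace_def sum.distrib sum_distrib_left)
  hence "bounded_linear (trace :: real^'n^'n \<Rightarrow> real)" by (simp add: linear_conv_bounded_linear)
  from bounded_linear_compose[OF this bounded_linear_compose[OF matmul.bounded_linear_left
      matmul.bounded_linear_right]]
  show ?thesis .
qed

text \<open>The two mixed terms are transposes of each other and have the same trace, hence the
  factor 2.\<close>

lemma norm_error_square:
  fixes H :: "real^'n^'q" and Q :: "real^'r^'n"
  shows "(norm (H ** (a - Q ** b)))\<^sup>2 =
    trace (H ** (a ** transpose a) ** transpose H) +
    trace ((H ** Q) ** (b ** transpose b) ** transpose (H ** Q)) -
    2 * trace ((H ** Q) ** (b ** transpose a) ** transpose H)"
proof -
  have tr: "trace (X + Y) = trace X + trace Y" "trace (X - Y) = trace X - trace Y" for X Y :: "real^'q^'q"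
    by (simp_all add: trace_def sum.distrib sum_subtractf)
  have "trace (H ** a ** transpose b ** transpose (H ** Q)) =
      trace (transpose (H ** a ** transpose b ** transpose (H ** Q)))"
    by (simp add: trace_transpose)
  hence "trace (H ** a ** transpose b ** transpose (H ** Q)) =
      trace (H ** Q ** b ** transpose a ** transpose H)"
    by (simp only: matrix_transpose_mul transpose_transpose matrix_mul_assoc)
  thus ?thesis
    by (simp add: norm_matrix_square_trace matmul.diff_left matmul.diff_right transpose_diff tr
        matrix_transpose_mul matrix_mul_assoc)
qed

text \<open>Finiteness matters also for the second claim: \<open>enn2real\<close> would send an
  infinite value to 0.\<close>

lemma h2_norm_exp_decaying:
  fixes h :: "real \<Rightarrow> real^'p^'q" and G :: "complex \<Rightarrow> complex^'p^'q"
  assumes h: "exp_decaying h"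
    and G: "\<And>s i j. 0 < Re s \<Longrightarrow> G s $ i $ j = laplace_transform (\<lambda>t. h t $ i $ j) s"
  shows "h2_square G < \<infinity>" "(h2_norm G)\<^sup>2 = (LINT t:{0..}|lborel. (norm (h t))\<^sup>2)"
proof -
  obtain K where K: "\<And>t. 0 \<le> t \<Longrightarrow> norm (h t) \<le> K" using exp_decaying_bounded[OF h] by metis
  have "continuous_on UNIV h" using h by (simp add: exp_decaying_def)
  from h2_square_laplace[OF this K G]
  have "h2_square G = (\<integral>\<^sup>+t. ennreal (indicator {0..} t *\<^sub>R (norm (h t))\<^sup>2) \<partial>lborel)"
    by (auto simp: indicator_def intro!: nn_integral_cong)
  also have "\<dots> = ennreal (LINT t:{0..}|lborel. (norm (h t))\<^sup>2)"
  proof -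
    have "set_integrable lborel {0..} (\<lambda>t. h t \<bullet> h t)"
      by (intro exp_decaying_set_integrable exp_decaying_bounded_bilinear[OF bounded_bilinear_inner] h)
    thus ?thesis unfolding set_lebesgue_integral_def set_integrable_def
      by (intro nn_integral_eq_integral) (auto simp: power2_norm_eq_inner)
  qed
  finally have eq: "h2_square G = ennreal (LINT t:{0..}|lborel. (norm (h t))\<^sup>2)" .
  thus "h2_square G < \<infinity>" by simp
  have "0 \<le> (LINT t:{0..}|lborel. (norm (h t))\<^sup>2)"
    unfolding set_lebesgue_integral_def by (intro Bochner_Integration.integral_nonneg) auto
  thus "(h2_norm G)\<^sup>2 = (LINT t:{0..}|lborel. (norm (h t))\<^sup>2)" by (simp add: h2_norm_def eq)
qed

lemma matrix_product_entry_bounded: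
  fixes B :: "real^'n^'m" and X :: "real \<Rightarrow> real^'n^'n" and D :: "real^'p^'n"
  assumes "\<And>t. 0 \<le> t \<Longrightarrow> norm (X t) \<le> K"
  obtains L where "\<And>t. 0 \<le> t \<Longrightarrow> \<bar>(B ** X t ** D) $ i $ j\<bar> \<le> L"
proof -
  have "bounded_linear (\<lambda>X :: real^'n^'n. (B ** X ** D) $ i $ j)"
    by (intro bounded_linear_compose[OF bounded_linear_vec_nth] bounded_linear_compose[OF
        matmul.bounded_linear_left]
        matmul.bounded_linear_right)
  from bounded_linear.nonneg_bounded[OF this] obtain L where
    L: "0 \<le> L" "\<And>X. \<bar>(B ** X ** D) $ i $ j\<bar> \<le> norm X * L" by auto
  have "\<bar>(B ** X t ** D) $ i $ j\<bar> \<le> K * L" if "0 \<le> t" for t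
    using order.trans[OF L(2) mult_right_mono[OF assms[OF that] L(1)]] .
  thus ?thesis using that by blast
qed

theorem theorem8:
  fixes E :: "('n::finite \<times> 'n) set"
    and W M \<L> J Po :: "real^'n^'n"
    and F :: "real^'p::finite^'n"
    and H :: "real^'n^'q::finite"
    and C :: "'r::finite \<Rightarrow> 'n set"
    and Q :: "real^'r^'n"
    and Qd Pt Px :: "real^'n^'r"
    and \<L>r Pr :: "real^'r^'r"
    and Fr :: "real^'p^'r"
    and Hr :: "real^'r^'q"
    and G :: "complex \<Rightarrow> complex^'p^'q"
  assumes graph: "weighted_digraph E W" "weakly_connected E"
    and laplacian: "\<L> = laplacian W"
    and balancing: "balancing_matrix E W M"
    and clustering: "proper_clustering (M ** \<L>) C"
    and Q: "Q = char_matrix C"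
    and Qd: "Qd = weighted_pinv M Q"
    and reduced: "\<L>r = Qd ** \<L> ** Q" "Fr = Qd ** F" "Hr = H ** Q"
    and gramians: "Po = pseudo_ctrb_gramian (- \<L>) F" "Pr = pseudo_ctrb_gramian (- \<L>r) Fr"
    and J: "J = exp_limit (- \<L>)"
    and sylvester: "\<L>r ** Pt + Pt ** transpose \<L>
        - Qd ** (mat 1 - J) ** F ** transpose F ** (mat 1 - transpose J) = 0"
    and Px: "Px = Pt - Qd ** J ** Q ** Pt ** transpose J"
    and G: "G = (\<lambda>s. transfer_function (- \<L>) F H s - transfer_function (- \<L>r) Fr Hr s)"
  shows "in_h2 G \<and>
    (h2_norm G)\<^sup>2 =
      trace (H ** (Po + Q ** Pr ** transpose Q - 2 *\<^sub>R (Q ** Px)) ** transpose H)"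
proof -
  obtain m where m: "\<And>i. 0 < m $ i" and M: "M = diag_mat m"
    using balancing by (auto simp: balancing_matrix_def)
  interpret weighted_clustering C m
    using clustering m by unfold_locales (auto simp: proper_clustering_def)
  have "0 \<le> W $ i $ j" for i j
    using graph(1) by (cases "(i, j) \<in> E") (auto simp: weighted_digraph_def less_imp_le)
  hence Z: "zero_row_sum_Z_matrix \<L>"
    unfolding laplacian by (rule zero_row_sum_Z_matrix_laplacian)
  have Zr: "zero_row_sum_Z_matrix \<L>r"
    unfolding reduced Qd Q M by (rule zero_row_sum_Z_matrix_reduced[OF Z])
  have QJ: "Q ** Qd ** J = J" and JQ: "J ** Q ** Qd = J"
    using clusterable_imp_exp_limit[OF Z] clustering by (simp_all add: Qd Q M J)
  define Jr where "Jr = exp_limit (- \<L>r)"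
  have Jr: "Jr = Qd ** J ** Q"
    using exp_limit_reduced[OF Z] clusterable_imp_exp_limit[OF Z] clustering
    by (simp add: Jr_def reduced Qd Q M J)
  have comm: "Qd ** J = Jr ** Qd"
    unfolding Jr using JQ by (simp flip: matrix_mul_assoc)
  \<comment> \<open>The steady-state parts of the full and the lifted reduced response coincide;
    they cancel in \<open>h_eq\<close>, which is why the error decays.\<close>
  have J_eq: "J = Q ** (Jr ** Qd)"
    unfolding comm[symmetric] using QJ by (simp add: matrix_mul_assoc)

  define T where "T = (\<lambda>t. matrix_exp (t *\<^sub>R (- \<L>)))"
  define Tr where "Tr = (\<lambda>t. matrix_exp (t *\<^sub>R (- \<L>r)))"
  define a where "a = (\<lambda>t. (T t - J) ** F)"
  define b where "b = (\<lambda>t. (Tr t - Jr) ** (Qd ** F))"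
  define h where "h = (\<lambda>t. H ** (a t - Q ** b t))"
  have a: "exp_decaying a" and b: "exp_decaying b"
    unfolding a_def b_def T_def Tr_def J Jr_def
    by (intro exp_decaying_bounded_linear[OF matmul.bounded_linear_left] exp_decaying_matrix_exp Z Zr)+
  have h: "exp_decaying h"
    unfolding h_def
    by (intro exp_decaying_bounded_linear[OF matmul.bounded_linear_right] exp_decaying_diff a b)
  have h_eq: "h t = H ** T t ** F - Hr ** Tr t ** Fr" for t
  proof -
    have "a t - Q ** b t = T t ** F - Q ** Tr t ** Qd ** F"
      by (simp add: a_def b_def matmul.diff_left matmul.diff_right J_eq matrix_mul_assoc)
    thus ?thesis unfolding h_def by (simp add: reduced matmul.diff_right matrix_mul_assoc)
  qed
  obtain K where K: "\<And>t. 0 \<le> t \<Longrightarrow> norm (T t) \<le> K"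
    using matrix_exp_bounded[OF Z] unfolding T_def by metis
  obtain Kr where Kr: "\<And>t. 0 \<le> t \<Longrightarrow> norm (Tr t) \<le> Kr"
    using matrix_exp_bounded[OF Zr] unfolding Tr_def by metis
  \<comment> \<open>\<open>h\<close> decays, but its two summands are only bounded; for
    \<open>Re s > 0\<close> this is enough to transform them separately.\<close>
  have G_entry: "G s $ i $ j = laplace_transform (\<lambda>t. h t $ i $ j) s" if s: "0 < Re s" for s i j
  proof -
    obtain L Lr where L: "\<And>t. 0 \<le> t \<Longrightarrow> \<bar>(H ** T t ** F) $ i $ j\<bar> \<le> L"
      and Lr: "\<And>t. 0 \<le> t \<Longrightarrow> \<bar>(Hr ** Tr t ** Fr) $ i $ j\<bar> \<le> Lr"
      using matrix_product_entry_bounded[where X = T, OF K] matrix_product_entry_bounded[where X = Tr, OF Kr]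
      by metis
    have cont: "continuous_on UNIV (\<lambda>t. (H ** T t ** F) $ i $ j)" "continuous_on UNIV (\<lambda>t. (Hr ** Tr t **
        Fr) $ i $ j)"
      unfolding T_def Tr_def by (intro continuous_intros matmul.continuous_on)+
    show ?thesis
      using laplace_transform_diff[OF cont(1) L cont(2) Lr s]
        transfer_function_entry[OF K[unfolded T_def] s, of F H i j]
        transfer_function_entry[OF Kr[unfolded Tr_def] s, of Fr Hr i j]
      by (simp add: G h_eq T_def Tr_def)
  qed
  note h2 = h2_norm_exp_decaying[OF h G_entry]
  have "(\<lambda>s. G s $ i $ j) holomorphic_on {s. 0 < Re s}" for i j
    unfolding G using transfer_function_holomorphic[OF K[unfolded T_def]]
      transfer_function_holomorphic[OF Kr[unfolded Tr_def]]
    by (auto intro!: holomorphic_intros)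
  hence "in_h2 G" unfolding in_h2_def using h2(1) by simp

  have aa: "exp_decaying (\<lambda>t. a t ** transpose (a t))" and bb: "exp_decaying (\<lambda>t. b t ** transpose (b t))"
    and ba: "exp_decaying (\<lambda>t. b t ** transpose (a t))"
    by (intro exp_decaying_bounded_bilinear[OF bounded_bilinear_matrix_mult]
        exp_decaying_bounded_linear[OF bounded_linear_transpose] a b)+
  have Po: "Po = (LINT t:{0..}|lborel. a t ** transpose (a t))"
    unfolding gramians a_def T_def J by (rule pseudo_ctrb_gramian_eq[OF Z])
  have Pr: "Pr = (LINT t:{0..}|lborel. b t ** transpose (b t))"
    unfolding gramians b_def Tr_def Jr_def reduced(2)[symmetric] by (rule pseudo_ctrb_gramian_eq[OF Zr])
  \<comment> \<open>The identity \<open>Jr\<close> turns the correction term of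
    \<open>cross_gramian\<close> into the one defining \<open>Px\<close>.\<close>
  have Px': "Px = (LINT t:{0..}|lborel. b t ** transpose (a t))"
    using cross_gramian[OF Z Zr comm[unfolded J Jr_def] sylvester[unfolded J]]
    by (simp add: Px a_def b_def T_def Tr_def J Jr_def[symmetric] Jr matrix_mul_assoc)
  have "(h2_norm G)\<^sup>2 = (LINT t:{0..}|lborel.
      trace (H ** (a t ** transpose (a t)) ** transpose H) +
      trace ((H ** Q) ** (b t ** transpose (b t)) ** transpose (H ** Q)) -
      2 * trace ((H ** Q) ** (b t ** transpose (a t)) ** transpose H))"
    by (simp only: h2(2) h_def norm_error_square)
  also have "\<dots> = trace (H ** Po ** transpose H) + trace ((H ** Q) ** Pr ** transpose (H ** Q)) -
      2 * trace ((H ** Q) ** Px ** transpose H)"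
  proof -
    note int = aa[THEN exp_decaying_set_integrable] bb[THEN exp_decaying_set_integrable]
      ba[THEN exp_decaying_set_integrable]
    note tr = exp_decaying_bounded_linear[OF linear_trace_congruence, THEN exp_decaying_set_integrable]
    show ?thesis
      unfolding Po Pr Px'
      by (simp add: set_integral_diff(2) set_integral_add set_integrable_mult_right tr aa bb ba
          set_integral_bounded_linear[OF linear_trace_congruence] int)
  qed
  also have "\<dots> = trace (H ** (Po + Q ** Pr ** transpose Q - 2 *\<^sub>R (Q ** Px)) ** transpose H)"
  proof -
    have "trace (X + Y - 2 *\<^sub>R X') = trace X + trace Y - 2 * trace X'" for X Y X' :: "real^'q^'q"
      by (simp add: trace_def sum.distrib sum_subtractf sum_distrib_left)
    thus ?thesis
      by (simp add: matmul.diff_left matmul.diff_right matmul.add_left matmul.add_right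
          matmul.scaleR_left matmul.scaleR_right matrix_transpose_mul matrix_mul_assoc)
  qed
  finally show ?thesis using \<open>in_h2 G\<close> by blast
qed

end
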